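(* Let $G_\infty(t)$ be an invariant Ricci flow on a nilpotent Lie group $\mathcal G$ that is a sequential blowdown limit of an invariant Ricci flow on a nilpotent Lie group. Then, for all $t\in(0,\infty)$, $$\delta\Big(\mathrm{Rc}_{G_\infty(t)}+\frac{\mathbb 1}{2t}\Big)=0 .$$
   Context: An invariant metric on a Lie group is a translation-invariant Riemannian metric; tensors are evaluated at the identity, i.e. on the Lie algebra $\mathfrak g$. For an invariant metric $G$ on a nilpotent Lie group with $G$-orthonormal basis $\{e_i\}$ of $\mathfrak g$, $\mathrm{Ric}_G(x,y)=-\frac12\sum_iG([x,e_i],[y,e_i])+\frac14\sum_{i,j}G([e_i,e_j],x)G([e_i,e_j],y)$, and $\mathrm{Rc}_G=G^{-1}\mathrm{Ric}_G\in\mathrm{End}\,\mathfrak g$ is defined by $G(\mathrm{Rc}_Gx,y)=\mathrm{Ric}_G(x,y)$. For $A\in\mathrm{End}\,\mathfrak g$, $\delta(A)(x,y)=A[x,y]-[Ax,y]-[x,Ay]$. An invariant Ricci flow is a family of invariant metrics with $\partial_tG=-2\mathrm{Ric}_G$. Blowdown limit: for an invariant Ricci flow $(\mathcal G',G(t))$, $t\in(0,\infty)$, on a nilpotent Lie group and $s_i>0$, $s_i\to\infty$, put $G_i(t)=s_i^{-1}G(s_it)$. $(\mathcal G,G_\infty(t))$ is a sequential blowdown limit of $G(t)$ if for some points $a_i\in\mathcal G'$, $a_\infty\in\mathcal G$ the sequence $(\mathcal G',a_i,G_i(t))$ Cheeger–Gromov converges to $(\mathcal G,a_\infty,G_\infty(t))$: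 there are an exhaustion $\{U_i\}$ of $\mathcal G$ by open subsets and diffeomorphisms $\phi_i:U_i\to V_i$ onto open subsets of $\mathcal G'$ with $\phi_i(a_\infty)=a_i$ such that $\phi_i^*G_i(t)\to G_\infty(t)$ smoothly and uniformly on compact subsets of $\mathcal G\times(0,\infty)$. *)

theory Defs
  imports "HOL-Analysis.Analysis" "HOL-Algebra.Group"
begin

section \<open>Smooth functions on open subsets of Euclidean space\<close>

primrec iterated_deriv ::
  "'a::real_normed_vector list \<Rightarrow> ('a \<Rightarrow> 'b::real_normed_vector) \<Rightarrow> 'a \<Rightarrow> 'b" where
  "iterated_deriv [] f = f"
| "iterated_deriv (v # vs) f = (\<lambda>x. frechet_derivative (iterated_deriv vs f) (at x) v)"

text \<open>Only used for open \<open>S\<close>. The derivatives are two-sided, so \<open>f\<close> is \<open>C\<^sup>\<infinity>\<close> on \<open>S\<close> iff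
  every iterated directional derivative exists and is again differentiable at every point of \<open>S\<close>.\<close>

definition smooth_on :: "'a::real_normed_vector set \<Rightarrow> ('a \<Rightarrow> 'b::real_normed_vector) \<Rightarrow> bool" where
  "smooth_on S f \<longleftrightarrow> (\<forall>vs. \<forall>x\<in>S. iterated_deriv vs f differentiable (at x))"

section \<open>Smooth manifolds\<close>

text \<open>The manifold is the whole type \<open>'m\<close>, whose class provides the Hausdorff second countable
  topology; the smooth structure is the one generated by an (arbitrary, not necessarily maximal)
  atlas with values in \<open>'e\<close>.\<close>

type_synonym ('m, 'e) chart = "'m set \<times> ('m \<Rightarrow> 'e)"
type_synonym ('m, 'e) atlas = "('m, 'e) chart set"

definition chart_inv :: "('m, 'e) chart \<Rightarrow> 'e \<Rightarrow> 'm" where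
  "chart_inv c = inv_into (fst c) (snd c)"

definition smooth_atlas ::
  "('m::{t2_space, second_countable_topology}, 'e::euclidean_space) atlas \<Rightarrow> bool" where
  "smooth_atlas A \<longleftrightarrow>
     (\<forall>(U, \<kappa>)\<in>A. open U \<and> open (\<kappa> ` U) \<and> homeomorphism U (\<kappa> ` U) \<kappa> (chart_inv (U, \<kappa>))) \<and>
     (\<Union>c\<in>A. fst c) = UNIV \<and>
     (\<forall>(U, \<kappa>)\<in>A. \<forall>(V, \<eta>)\<in>A. smooth_on (\<kappa> ` (U \<inter> V)) (\<eta> \<circ> chart_inv (U, \<kappa>)))"

definition euclid_atlas :: "('e, 'e) atlas" where
  "euclid_atlas = {(UNIV, id)}"

definition prod_atlas :: "('m, 'e) atlas \<Rightarrow> ('n, 'f) atlas \<Rightarrow> ('m \<times> 'n, 'e \<times> 'f) atlas" where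
  "prod_atlas A B = {(U \<times> V, map_prod \<kappa> \<eta>) | U \<kappa> V \<eta>. (U, \<kappa>) \<in> A \<and> (V, \<eta>) \<in> B}"

definition smooth_map_on ::
  "('m::topological_space, 'e::real_normed_vector) atlas \<Rightarrow>
   ('n::topological_space, 'f::real_normed_vector) atlas \<Rightarrow> 'm set \<Rightarrow> ('m \<Rightarrow> 'n) \<Rightarrow> bool" where
  "smooth_map_on A B S f \<longleftrightarrow> continuous_on S f \<and>
     (\<forall>(U, \<kappa>)\<in>A. \<forall>(V, \<eta>)\<in>B.
        smooth_on (\<kappa> ` (S \<inter> U \<inter> f -` V)) (\<eta> \<circ> f \<circ> chart_inv (U, \<kappa>)))"

definition diffeomorphism_between ::
  "('m::topological_space, 'e::real_normed_vector) atlas \<Rightarrow>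
   ('n::topological_space, 'f::real_normed_vector) atlas \<Rightarrow>
   'm set \<Rightarrow> 'n set \<Rightarrow> ('m \<Rightarrow> 'n) \<Rightarrow> bool" where
  "diffeomorphism_between A B U V f \<longleftrightarrow>
     bij_betw f U V \<and> smooth_map_on A B U f \<and> smooth_map_on B A V (inv_into U f)"

text \<open>The tangent space at \<open>p\<close> is the model space \<open>'e\<close>, identified with \<open>T\<^sub>p\<close> by the differential
  at \<open>p\<close> of one chosen chart around \<open>p\<close>. A vector field is therefore a function \<open>'m \<Rightarrow> 'e\<close> and a
  field of bilinear forms a function \<open>'m \<Rightarrow> 'e \<Rightarrow> 'e \<Rightarrow> real\<close>; as the chosen chart varies
  discontinuously with \<open>p\<close>, smoothness of such fields is always tested in a fixed chart.\<close>

definition chart_at :: "('m, 'e) atlas \<Rightarrow> 'm \<Rightarrow> ('m, 'e) chart" where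
  "chart_at A p = (SOME c. c \<in> A \<and> p \<in> fst c)"

definition tangent_map ::
  "('m, 'e::real_normed_vector) atlas \<Rightarrow> ('n, 'f::real_normed_vector) atlas \<Rightarrow>
   ('m \<Rightarrow> 'n) \<Rightarrow> 'm \<Rightarrow> 'e \<Rightarrow> 'f" where
  "tangent_map A B f p =
     frechet_derivative (snd (chart_at B (f p)) \<circ> f \<circ> chart_inv (chart_at A p))
       (at (snd (chart_at A p) p))"

definition field_in_chart ::
  "('m, 'e::real_normed_vector) atlas \<Rightarrow> ('m, 'e) chart \<Rightarrow> ('m \<Rightarrow> 'e) \<Rightarrow> 'e \<Rightarrow> 'e" where
  "field_in_chart A c X z =
     tangent_map A euclid_atlas (snd c) (chart_inv c z) (X (chart_inv c z))"

text \<open>The commutator of vector fields, in coordinates \<open>[X, Y] = DY(X) - DX(Y)\<close>. The result needs no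
  conversion because the chart used is the one identifying \<open>T\<^sub>p\<close> with \<open>'e\<close>.\<close>

definition field_bracket ::
  "('m, 'e::real_normed_vector) atlas \<Rightarrow> ('m \<Rightarrow> 'e) \<Rightarrow> ('m \<Rightarrow> 'e) \<Rightarrow> 'm \<Rightarrow> 'e" where
  "field_bracket A X Y p =
     (let c = chart_at A p; z = snd c p; X' = field_in_chart A c X; Y' = field_in_chart A c Y
      in frechet_derivative Y' (at z) (X' z) - frechet_derivative X' (at z) (Y' z))"

section \<open>Riemannian metrics\<close>

type_synonym ('m, 'e) metric = "'m \<Rightarrow> 'e \<Rightarrow> 'e \<Rightarrow> real"

definition pullback ::
  "('m, 'e::real_normed_vector) atlas \<Rightarrow> ('n, 'f::real_normed_vector) atlas \<Rightarrow>
   ('m \<Rightarrow> 'n) \<Rightarrow> ('n, 'f) metric \<Rightarrow> ('m, 'e) metric" where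
  "pullback A B f h p u v = h (f p) (tangent_map A B f p u) (tangent_map A B f p v)"

text \<open>\<open>metric_in_chart A c h z u v\<close> is the component \<open>h\<^sub>u\<^sub>v(z)\<close> of \<open>h\<close> in the coordinates \<open>c\<close>.\<close>

definition metric_in_chart ::
  "('m, 'e::real_normed_vector) atlas \<Rightarrow> ('m, 'e) chart \<Rightarrow> ('m, 'e) metric \<Rightarrow> ('e, 'e) metric" where
  "metric_in_chart A c h = pullback euclid_atlas A (chart_inv c) h"

definition inner_product :: "('e::real_vector \<Rightarrow> 'e \<Rightarrow> real) \<Rightarrow> bool" where
  "inner_product b \<longleftrightarrow> (\<forall>u. linear (b u)) \<and> (\<forall>u v. b u v = b v u) \<and> (\<forall>u. u \<noteq> 0 \<longrightarrow> 0 < b u u)"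

definition riemannian_metric ::
  "('m, 'e::real_normed_vector) atlas \<Rightarrow> ('m, 'e) metric \<Rightarrow> bool" where
  "riemannian_metric A h \<longleftrightarrow> (\<forall>p. inner_product (h p)) \<and>
     (\<forall>c\<in>A. \<forall>u v. smooth_on (snd c ` fst c) (\<lambda>z. metric_in_chart A c h z u v))"

section \<open>Lie groups\<close>

definition lie_group ::
  "('g::{t2_space, second_countable_topology}, 'e::euclidean_space) atlas \<Rightarrow> 'g monoid \<Rightarrow> bool" where
  "lie_group A \<G> \<longleftrightarrow> group \<G> \<and> carrier \<G> = UNIV \<and> smooth_atlas A \<and>
     smooth_map_on (prod_atlas A A) A UNIV (\<lambda>(p, q). p \<otimes>\<^bsub>\<G>\<^esub> q) \<and>
     smooth_map_on A A UNIV (\<lambda>p. inv\<^bsub>\<G>\<^esub> p)"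

definition left_invariant_field ::
  "('g, 'e::real_normed_vector) atlas \<Rightarrow> 'g monoid \<Rightarrow> 'e \<Rightarrow> 'g \<Rightarrow> 'e" where
  "left_invariant_field A \<G> x p = tangent_map A A (\<lambda>q. p \<otimes>\<^bsub>\<G>\<^esub> q) \<one>\<^bsub>\<G>\<^esub> x"

text \<open>The bracket of the Lie algebra \<open>T\<^sub>1\<close>, which is the type \<open>'e\<close> by the identification above.\<close>

definition lie_bracket ::
  "('g, 'e::real_normed_vector) atlas \<Rightarrow> 'g monoid \<Rightarrow> 'e \<Rightarrow> 'e \<Rightarrow> 'e" where
  "lie_bracket A \<G> x y =
     field_bracket A (left_invariant_field A \<G> x) (left_invariant_field A \<G> y) \<one>\<^bsub>\<G>\<^esub>"

primrec lower_central_series :: "('e::real_vector \<Rightarrow> 'e \<Rightarrow> 'e) \<Rightarrow> nat \<Rightarrow> 'e set" where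
  "lower_central_series br 0 = UNIV"
| "lower_central_series br (Suc k) = span {br x y | x y. y \<in> lower_central_series br k}"

text \<open>Connectedness is not required; for connected groups this is nilpotency of the group.\<close>

definition nilpotent_lie_group ::
  "('g::{t2_space, second_countable_topology}, 'e::euclidean_space) atlas \<Rightarrow> 'g monoid \<Rightarrow> bool" where
  "nilpotent_lie_group A \<G> \<longleftrightarrow>
     lie_group A \<G> \<and> (\<exists>k. lower_central_series (lie_bracket A \<G>) k = {0})"

text \<open>The coboundary \<open>\<delta>(T)\<close> of an endomorphism; it vanishes iff \<open>T\<close> is a derivation.\<close>

definition delta :: "('e::real_vector \<Rightarrow> 'e \<Rightarrow> 'e) \<Rightarrow> ('e \<Rightarrow> 'e) \<Rightarrow> 'e \<Rightarrow> 'e \<Rightarrow> 'e" where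
  "delta br T x y = T (br x y) - br (T x) y - br x (T y)"

section \<open>Invariant metrics and the Ricci flow\<close>

definition invariant_metric ::
  "('g, 'e::real_normed_vector) atlas \<Rightarrow> 'g monoid \<Rightarrow> ('g, 'e) metric \<Rightarrow> bool" where
  "invariant_metric A \<G> h \<longleftrightarrow> riemannian_metric A h \<and>
     (\<forall>a. pullback A A (\<lambda>q. a \<otimes>\<^bsub>\<G>\<^esub> q) h = h)"

definition orthonormal_basis :: "('e::real_vector \<Rightarrow> 'e \<Rightarrow> real) \<Rightarrow> 'e set \<Rightarrow> bool" where
  "orthonormal_basis b E \<longleftrightarrow> finite E \<and> span E = UNIV \<and>
     (\<forall>u\<in>E. \<forall>v\<in>E. b u v = (if u = v then 1 else 0))"

text \<open>The Ricci tensor of an invariant metric on a nilpotent group, evaluated at the identity, in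
  terms of the bracket \<open>br\<close> and the inner product \<open>b\<close> on the Lie algebra. The value does not
  depend on the orthonormal basis.\<close>

definition Ric ::
  "('e::real_vector \<Rightarrow> 'e \<Rightarrow> 'e) \<Rightarrow> ('e \<Rightarrow> 'e \<Rightarrow> real) \<Rightarrow> 'e \<Rightarrow> 'e \<Rightarrow> real" where
  "Ric br b x y = (let E = SOME E. orthonormal_basis b E in
     - (1/2) * (\<Sum>e\<in>E. b (br x e) (br y e)) +
     (1/4) * (\<Sum>e\<in>E. \<Sum>e'\<in>E. b (br e e') x * b (br e e') y))"

definition Rc ::
  "('e::real_vector \<Rightarrow> 'e \<Rightarrow> 'e) \<Rightarrow> ('e \<Rightarrow> 'e \<Rightarrow> real) \<Rightarrow> 'e \<Rightarrow> 'e" where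
  "Rc br b x = (THE z. \<forall>y. b z y = Ric br b x y)"

text \<open>Both sides of the flow equation are left-invariant tensors, so it is imposed at the identity.
  The flow lives on the time interval \<open>(0, \<infinity>)\<close>; values at other times are irrelevant.\<close>

definition invariant_ricci_flow ::
  "('g, 'e::real_normed_vector) atlas \<Rightarrow> 'g monoid \<Rightarrow> (real \<Rightarrow> ('g, 'e) metric) \<Rightarrow> bool" where
  "invariant_ricci_flow A \<G> G \<longleftrightarrow>
     (\<forall>t>0. invariant_metric A \<G> (G t)) \<and>
     (\<forall>t>0. \<forall>x y. ((\<lambda>t. G t \<one>\<^bsub>\<G>\<^esub> x y) has_real_derivative
                     - 2 * Ric (lie_bracket A \<G>) (G t \<one>\<^bsub>\<G>\<^esub>) x y) (at t))"

section \<open>Cheeger--Gromov convergence and blowdown limits\<close>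

text \<open>Locally smooth convergence on \<open>'m \<times> (0, \<infinity>)\<close>: in every chart all space-time derivatives of
  all components converge uniformly on compact sets.\<close>

definition smooth_convergence ::
  "('m, 'e::real_normed_vector) atlas \<Rightarrow> (nat \<Rightarrow> real \<Rightarrow> ('m, 'e) metric) \<Rightarrow>
   (real \<Rightarrow> ('m, 'e) metric) \<Rightarrow> bool" where
  "smooth_convergence A H h \<longleftrightarrow>
     (\<forall>c\<in>A. \<forall>K vs u v. compact K \<and> K \<subseteq> (snd c ` fst c) \<times> {0<..} \<longrightarrow>
        uniform_limit K
          (\<lambda>i. iterated_deriv vs (\<lambda>(z, t). metric_in_chart A c (H i t) z u v))
          (iterated_deriv vs (\<lambda>(z, t). metric_in_chart A c (h t) z u v))
          sequentially)"

text \<open>The pullbacks below are meaningful on \<open>U i\<close> only, but every compact set lies in \<open>U i\<close> for all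
  large \<open>i\<close> -- this is what exhaustion means here -- so the values elsewhere do not matter.\<close>

definition cheeger_gromov_converges ::
  "('n::topological_space, 'e::real_normed_vector) atlas \<Rightarrow> (nat \<Rightarrow> 'n) \<Rightarrow>
   (nat \<Rightarrow> real \<Rightarrow> ('n, 'e) metric) \<Rightarrow>
   ('m::topological_space, 'e) atlas \<Rightarrow> 'm \<Rightarrow> (real \<Rightarrow> ('m, 'e) metric) \<Rightarrow> bool" where
  "cheeger_gromov_converges B a H A a' h \<longleftrightarrow>
     (\<exists>U V \<phi>.
        (\<forall>i. open (U i) \<and> a' \<in> U i \<and> open (V i) \<and>
             diffeomorphism_between A B (U i) (V i) (\<phi> i) \<and> \<phi> i a' = a i) \<and>
        (\<forall>K. compact K \<longrightarrow> (\<forall>\<^sub>F i in sequentially. K \<subseteq> U i)) \<and>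
        smooth_convergence A (\<lambda>i t. pullback A B (\<phi> i) (H i t)) h)"

definition sequential_blowdown_limit ::
  "('n::topological_space, 'e::real_normed_vector) atlas \<Rightarrow> (real \<Rightarrow> ('n, 'e) metric) \<Rightarrow>
   ('m::topological_space, 'e) atlas \<Rightarrow> (real \<Rightarrow> ('m, 'e) metric) \<Rightarrow> bool" where
  "sequential_blowdown_limit B G A h \<longleftrightarrow>
     (\<exists>s a a'. (\<forall>i. 0 < s i) \<and> filterlim s at_top sequentially \<and>
        cheeger_gromov_converges B a (\<lambda>i t p u v. inverse (s i) * G (s i * t) p u v) A a' h)"

end

theory Submission
  imports "Jordan_Normal_Form.Determinant" Defs
begin

text \<open>
  Let \<open>\<mu>\<close> be the bracket of the Lie algebra and \<open>f(t) = |\<mu>|\<^sup>2\<close> its squared norm in \<open>G(t)\<close>, which is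
  \<open>-4\<close> times the scalar curvature. The Ricci tensor of a nilpotent group is the moment map of the
  action of endomorphisms on brackets: \<open>tr (Rc T) = \<langle>\<delta>(T), \<mu>\<rangle> / 4\<close> for every endomorphism \<open>T\<close>
  (\<open>trace_Rc\<close>). Along the Ricci flow this gives, with \<open>N = tr (Rc\<^sup>2) = \<langle>\<delta>(Rc), \<mu>\<rangle> / 4\<close>,
  \<open>f' = -8 N\<close> and \<open>N' = -|\<delta>(Rc)|\<^sup>2\<close>. The Cauchy--Schwarz inequality \<open>(4 N)\<^sup>2 \<le> |\<delta>(Rc)|\<^sup>2 f\<close> then says
  exactly that \<open>1/f\<close> is concave, and equality means that \<open>\<delta>(Rc)\<close> is proportional to \<open>\<mu>\<close>.

  The slope of a positive concave function on \<open>(0, \<infinity>)\<close> decreases to a finite limit, so \<open>t f(t)\<close> has a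
  limit \<open>c \<in> (0, \<infinity>]\<close> as \<open>t \<rightarrow> \<infinity>\<close> unless \<open>\<mu> = 0\<close>. On a blowdown limit this forces \<open>f\<^sub>\<infinity>(t) = c / t\<close>
  with finite \<open>c\<close>; then \<open>1/f\<^sub>\<infinity>\<close> is affine, equality holds in the Cauchy--Schwarz inequality, and
  \<open>|\<delta>(Rc) - \<mu>/(2t)|\<^sup>2 = 0\<close>, which is the claim because \<open>\<delta>(\<one>) = -\<mu>\<close>.

  The passage to the limit is made at the level of volumes instead of curvatures. Since \<open>f\<close> is the
  time derivative of \<open>\<psi> = 2 log |det G|\<close>, it is enough to control the differences
  \<open>\<psi>(s\<^sub>i t) - \<psi>(s\<^sub>i)\<close>. By left invariance each metric at a point is a linear pullback, by a map not
  depending on \<open>t\<close>, of the metric at the identity; a linear change of basis multiplies the Gram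
  determinant by a constant, which cancels in the differences. So pointwise convergence of the
  pulled back metrics at the base point gives \<open>\<psi>(s\<^sub>i t) - \<psi>(s\<^sub>i) \<rightarrow> \<psi>\<^sub>\<infinity>(t) - \<psi>\<^sub>\<infinity>(1)\<close>
  (\<open>blowdown_limit_log_det\<close>), while the asymptotics of \<open>t f(t)\<close> identify this limit as \<open>c log t\<close>
  (\<open>log_det_blowdown\<close>).
\<close>

section \<open>Inner products and dual vectors\<close>

lemma inner_productD:
  assumes "inner_product b"
  shows inner_product_linear: "linear (b u)"
    and inner_product_sym: "b u v = b v u"
    and inner_product_pos: "u \<noteq> 0 \<Longrightarrow> 0 < b u u"
  using assms unfolding inner_product_def by blast+

lemma inner_product_bilinear:
  assumes "inner_product b"
  shows "bilinear b"
proof -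
  have "(\<lambda>x. b x y) = b y" for y
    using inner_product_sym[OF assms] by auto
  then show ?thesis
    unfolding bilinear_def using inner_product_linear[OF assms] by auto
qed

lemma inner_product_nonneg:
  assumes "inner_product b" shows "0 \<le> b u u"
  using inner_product_pos[OF assms, of u] bilinear_lzero[OF inner_product_bilinear[OF assms], of u]
  by (cases "u = 0") (auto simp: less_imp_le)

lemma inner_product_eq_0:
  assumes "inner_product b" shows "b u u = 0 \<longleftrightarrow> u = 0"
  using inner_product_pos[OF assms, of u] bilinear_lzero[OF inner_product_bilinear[OF assms], of u]
  by (cases "u = 0") auto

lemma inner_product_nondegenerate:
  assumes "inner_product b" "\<And>y. b u y = b v y"
  shows "u = v"
proof -
  have "b (u - v) (u - v) = b u (u - v) - b v (u - v)"
    by (rule bilinear_lsub[OF inner_product_bilinear[OF assms(1)]])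
  also have "\<dots> = 0" using assms(2) by simp
  finally show ?thesis using inner_product_eq_0[OF assms(1)] by auto
qed

lemma bilinear_expand:
  fixes Q :: "'e::euclidean_space \<Rightarrow> 'e \<Rightarrow> 'f::real_vector"
  assumes "bilinear Q"
  shows "Q x y = (\<Sum>i\<in>Basis. \<Sum>j\<in>Basis. (inner x i * inner y j) *\<^sub>R Q i j)"
proof -
  have "Q x y = Q (\<Sum>i\<in>Basis. inner x i *\<^sub>R i) (\<Sum>j\<in>Basis. inner y j *\<^sub>R j)"
    by (simp only: euclidean_representation)
  then show ?thesis
    by (simp add: bilinear_sum[OF assms] sum.cartesian_product bilinear_lmul[OF assms]
        bilinear_rmul[OF assms] mult.commute)
qed

lemma riesz_ex:
  fixes b :: "'e::euclidean_space \<Rightarrow> 'e \<Rightarrow> real"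
  assumes b: "inner_product b" and L: "linear L"
  obtains z where "\<And>y. b z y = L y"
proof -
  define S where "S x = (\<Sum>i\<in>Basis. b x i *\<^sub>R i)" for x
  have bil: "bilinear b" by (rule inner_product_bilinear[OF b])
  have linS: "linear S"
    unfolding S_def
    by (rule linearI) (simp_all add: bilinear_ladd[OF bil] bilinear_lmul[OF bil]
        scaleR_left_distrib sum.distrib scaleR_sum_right)
  have S: "inner (S x) y = b x y" for x y
  proof -
    have "b x y = b x (\<Sum>i\<in>Basis. inner y i *\<^sub>R i)"
      by (simp only: euclidean_representation)
    also have "\<dots> = (\<Sum>i\<in>Basis. inner y i * b x i)"
      using inner_product_linear[OF b, of x] by (simp add: linear_sum linear_scale)
    also have "\<dots> = inner (S x) y"
      by (simp add: S_def inner_sum_left inner_commute[of y] mult.commute)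
    finally show ?thesis by simp
  qed
  have "inj S"
    unfolding linear_injective_0[OF linS]
    using S inner_product_eq_0[OF b] by (metis inner_zero_left)
  then have "surj S" using linS by (simp add: linear_injective_imp_surjective)
  then obtain z where z: "S z = (\<Sum>i\<in>Basis. L i *\<^sub>R i)" by (metis surjD)
  have "b z y = L y" for y
  proof -
    have "b z y = inner (\<Sum>i\<in>Basis. L i *\<^sub>R i) y" using S[of z y] z by simp
    also have "\<dots> = (\<Sum>i\<in>Basis. inner y i * L i)"
      unfolding inner_sum_left by (simp add: inner_commute[of y] mult.commute)
    also have "\<dots> = L (\<Sum>i\<in>Basis. inner y i *\<^sub>R i)"
      using L by (simp only: linear_sum linear_scale[OF L] real_scaleR_def)
    also have "\<dots> = L y" by (simp only: euclidean_representation)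
    finally show ?thesis .
  qed
  then show ?thesis using that by blast
qed

text \<open>
  This is \<open>b\<inverse>\<close> applied to the covector \<open>\<langle>x, \<cdot>\<rangle>\<close>. The vectors \<open>dual_vec b i\<close> for \<open>i \<in> Basis\<close> form the
  \<open>b\<close>-dual basis of \<open>Basis\<close>: unlike an orthonormal basis, this dual basis depends canonically and
  differentiably on \<open>b\<close>, which is what makes it possible to differentiate traces with respect to
  \<open>b\<close>.
\<close>

definition dual_vec :: "('e::euclidean_space \<Rightarrow> 'e \<Rightarrow> real) \<Rightarrow> 'e \<Rightarrow> 'e" where
  "dual_vec b x = (THE z. \<forall>y. b z y = inner x y)"

lemma dual_vec:
  assumes b: "inner_product b"
  shows "b (dual_vec b x) y = inner x y"
proof -
  have "linear (inner x)" by (simp add: bounded_linear.linear bounded_linear_inner_right)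
  then obtain z where z: "\<And>y. b z y = inner x y" using riesz_ex[OF b] by blast
  have "\<forall>y. b (dual_vec b x) y = inner x y"
    unfolding dual_vec_def
    by (rule theI[of _ z]) (auto simp: z intro!: inner_product_nondegenerate[OF b])
  then show ?thesis by blast
qed

lemma dual_vec_right:
  assumes b: "inner_product b"
  shows "b y (dual_vec b x) = inner y x"
  using dual_vec[OF b] inner_product_sym[OF b] by (metis inner_commute)

lemma dual_vec_expand:
  assumes b: "inner_product b"
  shows "(\<Sum>i\<in>Basis. b x i *\<^sub>R dual_vec b i) = x"
proof (rule inner_product_nondegenerate[OF b])
  fix y
  have bil: "bilinear b" by (rule inner_product_bilinear[OF b])
  have lin: "linear (\<lambda>x. b x y)" using bil by (auto simp: bilinear_def)
  have "b (\<Sum>i\<in>Basis. b x i *\<^sub>R dual_vec b i) y = (\<Sum>i\<in>Basis. b x i * inner i y)"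
    by (simp add: linear_sum[OF lin] bilinear_lmul[OF bil] dual_vec[OF b])
  also have "\<dots> = b x (\<Sum>i\<in>Basis. inner y i *\<^sub>R i)"
    using inner_product_linear[OF b, of x]
    by (simp add: linear_sum linear_scale inner_commute mult.commute)
  also have "\<dots> = b x y" by (simp only: euclidean_representation)
  finally show "b (\<Sum>i\<in>Basis. b x i *\<^sub>R dual_vec b i) y = b x y" .
qed

section \<open>Orthonormal bases\<close>

lemma orthonormal_independent:
  fixes E :: "'e::real_vector set"
  assumes b: "inner_product b" and on: "\<forall>u\<in>E. \<forall>v\<in>E. b u v = (if u = v then 1 else 0)"
  shows "independent E"
proof
  assume "dependent E"
  then obtain S c v where S: "finite S" "S \<subseteq> E" "(\<Sum>u\<in>S. c u *\<^sub>R u) = 0" "v \<in> S" "c v \<noteq> (0::real)"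
    unfolding dependent_explicit by blast
  have lin: "linear (b v)" by (rule inner_product_linear[OF b])
  have "0 = b v (\<Sum>u\<in>S. c u *\<^sub>R u)" using S(3) lin by (simp add: linear_0)
  also have "\<dots> = (\<Sum>u\<in>S. c u * b v u)"
    by (simp add: linear_sum[OF lin] linear_scale[OF lin])
  also have "\<dots> = (\<Sum>u\<in>S. c u * (if v = u then 1 else 0))"
    using on S(2,4) by (intro sum.cong refl arg_cong[where f = "\<lambda>r. _ * r"]) blast
  also have "\<dots> = c v" using S by (simp add: if_distrib cong: if_cong)
  finally show False using S by simp
qed

lemma orthonormal_expand:
  fixes b :: "'e::real_vector \<Rightarrow> 'e \<Rightarrow> real"
  assumes b: "inner_product b" and E: "orthonormal_basis b E"
  shows "(\<Sum>e\<in>E. b x e *\<^sub>R e) = x"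
proof -
  have fin: "finite E" and sp: "span E = UNIV"
    and on: "\<And>u v. u \<in> E \<Longrightarrow> v \<in> E \<Longrightarrow> b u v = (if u = v then 1 else 0)"
    using E unfolding orthonormal_basis_def by auto
  have "x \<in> span E" using sp by simp
  then obtain c where c: "x = (\<Sum>v\<in>E. c v *\<^sub>R v)"
    using span_finite[OF fin] by auto
  have "b x e = c e" if "e \<in> E" for e
  proof -
    have lin: "linear (b e)" by (rule inner_product_linear[OF b])
    have "b x e = b e x" by (rule inner_product_sym[OF b])
    also have "\<dots> = (\<Sum>v\<in>E. c v * (if e = v then 1 else 0))"
      unfolding c using that on
      by (auto simp: linear_sum[OF lin] linear_scale[OF lin] intro!: sum.cong)
    also have "\<dots> = c e" using that fin by (simp add: if_distrib cong: if_cong)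
    finally show ?thesis .
  qed
  then show ?thesis using c by simp
qed

text \<open>
  A \<open>b\<close>-orthonormal set of maximal cardinality spans: otherwise the normalised \<open>b\<close>-orthogonal
  component of a vector outside its span could be added to it.
\<close>

lemma orthonormal_basis_exists:
  fixes b :: "'e::euclidean_space \<Rightarrow> 'e \<Rightarrow> real"
  assumes b: "inner_product b"
  obtains E where "orthonormal_basis b E"
proof -
  define P where "P E \<longleftrightarrow> (\<forall>u\<in>E. \<forall>v\<in>E. b u v = (if u = v then 1 else 0))" for E
  have bound: "finite E \<and> card E \<le> DIM('e)" if "P E" for E
    using orthonormal_independent[OF b] that independent_bound unfolding P_def by blast
  have "\<exists>E. P E \<and> (\<forall>F. P F \<longrightarrow> card F \<le> card E)"
    by (rule ex_has_greatest_nat[of P "{}" card "DIM('e) + 1"])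
       (use bound in \<open>auto simp: P_def less_Suc_eq_le\<close>)
  then obtain E where E: "P E" and max: "\<And>F. P F \<Longrightarrow> card F \<le> card E" by blast
  have fin: "finite E" using bound[OF E] by simp
  have bil: "bilinear b" by (rule inner_product_bilinear[OF b])
  have "x \<in> span E" for x
  proof (rule ccontr)
    assume x: "x \<notin> span E"
    define y where "y = x - (\<Sum>e\<in>E. b x e *\<^sub>R e)"
    have inspan: "(\<Sum>e\<in>E. b x e *\<^sub>R e) \<in> span E"
      by (intro span_sum span_scale span_base)
    have "y \<notin> span E"
    proof
      assume "y \<in> span E"
      from span_add[OF this inspan] show False using x by (simp add: y_def)
    qed
    then have y0: "y \<noteq> 0" using span_0 by metis
    have orth: "b y e = 0" if "e \<in> E" for e
    proof -
      have lin: "linear (b e)" by (rule inner_product_linear[OF b])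
      have "b y e = b e y" by (rule inner_product_sym[OF b])
      also have "\<dots> = b e x - (\<Sum>v\<in>E. b x v * (if e = v then 1 else 0))"
        unfolding y_def using that E
        by (auto simp: linear_diff[OF lin] linear_sum[OF lin] linear_scale[OF lin] P_def
            intro!: sum.cong)
      also have "\<dots> = b e x - b x e" using that fin by (simp add: if_distrib cong: if_cong)
      also have "\<dots> = 0" using inner_product_sym[OF b, of e x] by simp
      finally show ?thesis .
    qed
    define r where "r = sqrt (b y y)"
    have r: "r > 0" "r * r = b y y"
      using inner_product_pos[OF b y0] unfolding r_def by auto
    define z where "z = (1 / r) *\<^sub>R y"
    have z1: "b z z = 1"
      unfolding z_def using r by (simp add: bilinear_lmul[OF bil] bilinear_rmul[OF bil] flip: r(2))
    have z0: "b z e = 0" "b e z = 0" if "e \<in> E" for e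
      unfolding z_def using orth[OF that] inner_product_sym[OF b, of e y]
      by (simp_all add: bilinear_lmul[OF bil] bilinear_rmul[OF bil])
    have "z \<notin> E" using z0 z1 by force
    moreover have "P (insert z E)"
      unfolding P_def using E[unfolded P_def] z0 z1 \<open>z \<notin> E\<close> by auto
    ultimately show False using max[of "insert z E"] fin by simp
  qed
  then have "orthonormal_basis b E"
    using E fin unfolding orthonormal_basis_def P_def by auto
  then show ?thesis by (rule that)
qed

text \<open>
  Both sides are the \<open>b\<close>-trace of \<open>Q\<close>. This translates between the two ways to compute traces:
  dual bases for derivatives, orthonormal bases for positivity and algebraic identities.
\<close>

lemma contraction_orthonormal:
  fixes Q :: "'e::euclidean_space \<Rightarrow> 'e \<Rightarrow> 'f::real_vector"
  assumes b: "inner_product b" and E: "orthonormal_basis b E" and Q: "bilinear Q"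
  shows "(\<Sum>i\<in>Basis. Q i (dual_vec b i)) = (\<Sum>e\<in>E. Q e e)"
proof -
  have fin: "finite E" using E by (simp add: orthonormal_basis_def)
  have l: "linear (\<lambda>x. Q x y)" and r: "linear (Q y)" for y
    using Q by (auto simp: bilinear_def)
  have "(\<Sum>i\<in>Basis. Q i (dual_vec b i))
      = (\<Sum>i\<in>Basis. Q (\<Sum>e\<in>E. b i e *\<^sub>R e) (dual_vec b i))"
    by (simp only: orthonormal_expand[OF b E])
  also have "\<dots> = (\<Sum>i\<in>Basis. \<Sum>e\<in>E. Q e (b e i *\<^sub>R dual_vec b i))"
    by (simp add: linear_sum[OF l] linear_scale[OF l] linear_scale[OF r] inner_product_sym[OF b])
  also have "\<dots> = (\<Sum>e\<in>E. Q e (\<Sum>i\<in>Basis. b e i *\<^sub>R dual_vec b i))"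
    by (subst sum.swap) (simp add: linear_sum[OF r])
  also have "\<dots> = (\<Sum>e\<in>E. Q e e)"
    by (simp only: dual_vec_expand[OF b])
  finally show ?thesis .
qed

section \<open>The Ricci tensor as moment map\<close>

text \<open>
  The inner product of tensors \<open>P, Q\<close> induced by \<open>b\<close>, written with a basis and its \<open>b\<close>-dual basis.
\<close>

definition tensor_ip where
  "tensor_ip b P Q = (\<Sum>i\<in>Basis. \<Sum>j\<in>Basis. b (P i j) (Q (dual_vec b i) (dual_vec b j)))"

lemma tensor_ip_orthonormal:
  fixes P Q :: "'e::euclidean_space \<Rightarrow> 'e \<Rightarrow> 'e"
  assumes b: "inner_product b" and E: "orthonormal_basis b E" and P: "bilinear P" and Q: "bilinear Q"
  shows "tensor_ip b P Q = (\<Sum>e\<in>E. \<Sum>e'\<in>E. b (P e e') (Q e e'))"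
proof -
  have bil: "bilinear b" by (rule inner_product_bilinear[OF b])
  note simps = linear_iff bilinear_ladd[OF bil] bilinear_radd[OF bil] bilinear_lmul[OF bil]
    bilinear_rmul[OF bil] bilinear_ladd[OF P] bilinear_radd[OF P] bilinear_lmul[OF P]
    bilinear_rmul[OF P] bilinear_ladd[OF Q] bilinear_radd[OF Q] bilinear_lmul[OF Q]
    bilinear_rmul[OF Q]
  have "bilinear (\<lambda>x y. \<Sum>j\<in>Basis. b (P x j) (Q y (dual_vec b j)))"
    unfolding bilinear_def by (simp add: simps sum.distrib sum_distrib_left)
  from contraction_orthonormal[OF b E this]
  have "tensor_ip b P Q = (\<Sum>e\<in>E. \<Sum>j\<in>Basis. b (P e j) (Q e (dual_vec b j)))"
    unfolding tensor_ip_def .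
  moreover have "bilinear (\<lambda>x y. b (P e x) (Q e y))" for e
    unfolding bilinear_def by (simp add: simps)
  from contraction_orthonormal[OF b E this]
  have "(\<Sum>j\<in>Basis. b (P e j) (Q e (dual_vec b j))) = (\<Sum>e'\<in>E. b (P e e') (Q e e'))" for e .
  ultimately show ?thesis by simp
qed

lemma tensor_ip_sym:
  fixes P Q :: "'e::euclidean_space \<Rightarrow> 'e \<Rightarrow> 'e"
  assumes b: "inner_product b" and P: "bilinear P" and Q: "bilinear Q"
  shows "tensor_ip b P Q = tensor_ip b Q P"
proof -
  obtain E where E: "orthonormal_basis b E" using orthonormal_basis_exists[OF b] by blast
  show ?thesis
    unfolding tensor_ip_orthonormal[OF b E P Q] tensor_ip_orthonormal[OF b E Q P]
    by (simp add: inner_product_sym[OF b])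
qed

lemma tensor_ip_nonneg:
  fixes P :: "'e::euclidean_space \<Rightarrow> 'e \<Rightarrow> 'e"
  assumes b: "inner_product b" and P: "bilinear P"
  shows "0 \<le> tensor_ip b P P"
proof -
  obtain E where E: "orthonormal_basis b E" using orthonormal_basis_exists[OF b] by blast
  show ?thesis
    unfolding tensor_ip_orthonormal[OF b E P P]
    by (intro sum_nonneg) (simp add: inner_product_nonneg[OF b])
qed

lemma tensor_ip_eq_0:
  fixes P :: "'e::euclidean_space \<Rightarrow> 'e \<Rightarrow> 'e"
  assumes b: "inner_product b" and P: "bilinear P" and 0: "tensor_ip b P P = 0"
  shows "P x y = 0"
proof -
  obtain E where E: "orthonormal_basis b E" using orthonormal_basis_exists[OF b] by blast
  have fin: "finite E" using E by (simp add: orthonormal_basis_def)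
  have z: "P e e' = 0" if "e \<in> E" "e' \<in> E" for e e'
  proof -
    have "(\<Sum>e\<in>E. \<Sum>e'\<in>E. b (P e e') (P e e')) = 0"
      using 0 tensor_ip_orthonormal[OF b E P P] by simp
    then have "(\<Sum>e'\<in>E. b (P e e') (P e e')) = 0"
      using fin that inner_product_nonneg[OF b]
      by (subst (asm) sum_nonneg_eq_0_iff) (auto intro!: sum_nonneg)
    then have "b (P e e') (P e e') = 0"
      using fin that inner_product_nonneg[OF b] by (subst (asm) sum_nonneg_eq_0_iff) auto
    then show ?thesis using inner_product_eq_0[OF b] by blast
  qed
  have "P x y = P (\<Sum>e\<in>E. b x e *\<^sub>R e) (\<Sum>e\<in>E. b y e *\<^sub>R e)"
    by (simp only: orthonormal_expand[OF b E])
  also have "\<dots> = 0"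
    unfolding bilinear_sum[OF P] using z
    by (intro sum.neutral) (auto simp: bilinear_lmul[OF P] bilinear_rmul[OF P])
  finally show ?thesis .
qed

lemma tensor_ip_square_diff:
  fixes P Q :: "'e::euclidean_space \<Rightarrow> 'e \<Rightarrow> 'e"
  assumes b: "inner_product b" and P: "bilinear P" and Q: "bilinear Q"
  shows "tensor_ip b (\<lambda>x y. P x y - k *\<^sub>R Q x y) (\<lambda>x y. P x y - k *\<^sub>R Q x y) =
     tensor_ip b P P - 2 * k * tensor_ip b P Q + k\<^sup>2 * tensor_ip b Q Q"
proof -
  have bil: "bilinear b" by (rule inner_product_bilinear[OF b])
  have "tensor_ip b (\<lambda>x y. P x y - k *\<^sub>R Q x y) (\<lambda>x y. P x y - k *\<^sub>R Q x y) =
     tensor_ip b P P - k * tensor_ip b P Q - k * tensor_ip b Q P + k\<^sup>2 * tensor_ip b Q Q"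
    unfolding tensor_ip_def
    by (simp add: bilinear_lsub[OF bil] bilinear_rsub[OF bil] bilinear_lmul[OF bil]
      bilinear_rmul[OF bil] sum.distrib sum_subtractf sum_distrib_left power2_eq_square ring_distribs
      mult.assoc)
  then show ?thesis using tensor_ip_sym[OF b P Q] by simp
qed

lemma bilinear_diff_scaleR:
  "bilinear P \<Longrightarrow> bilinear Q \<Longrightarrow> bilinear (\<lambda>x y. P x y - k *\<^sub>R Q x y)"
  by (auto simp: bilinear_def linear_iff algebra_simps)

text \<open>
  The inequality is the nonnegativity of the squared norm of \<open>P - k Q\<close> for the minimising \<open>k\<close>.
\<close>

lemma tensor_ip_Cauchy_Schwarz:
  fixes P Q :: "'e::euclidean_space \<Rightarrow> 'e \<Rightarrow> 'e"
  assumes b: "inner_product b" and P: "bilinear P" and Q: "bilinear Q" and pos: "tensor_ip b Q Q > 0"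
  shows "(tensor_ip b P Q)\<^sup>2 \<le> tensor_ip b P P * tensor_ip b Q Q"
proof -
  define k where "k = tensor_ip b P Q / tensor_ip b Q Q"
  have "0 \<le> tensor_ip b P P - 2 * k * tensor_ip b P Q + k\<^sup>2 * tensor_ip b Q Q"
    using tensor_ip_nonneg[OF b bilinear_diff_scaleR[OF P Q, of k]]
    unfolding tensor_ip_square_diff[OF b P Q] .
  also have "\<dots> = tensor_ip b P P - (tensor_ip b P Q)\<^sup>2 / tensor_ip b Q Q"
    unfolding k_def using pos by (simp add: field_simps power2_eq_square)
  finally show ?thesis using pos by (simp add: field_simps)
qed

definition trace_op :: "('e::euclidean_space \<Rightarrow> 'e) \<Rightarrow> real" where
  "trace_op T = (\<Sum>i\<in>Basis. inner (T i) i)"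

locale metric_bracket =
  fixes b :: "'e::euclidean_space \<Rightarrow> 'e \<Rightarrow> real" and br :: "'e \<Rightarrow> 'e \<Rightarrow> 'e"
  assumes ip: "inner_product b" and bil_br: "bilinear br" and anti: "br x y = - br y x"
begin

lemma bil: "bilinear b" by (rule inner_product_bilinear[OF ip])

lemmas bil_simps =
  bilinear_ladd[OF bil] bilinear_radd[OF bil] bilinear_lmul[OF bil] bilinear_rmul[OF bil]
  bilinear_lsub[OF bil] bilinear_rsub[OF bil] bilinear_lneg[OF bil] bilinear_rneg[OF bil]
  bilinear_ladd[OF bil_br] bilinear_radd[OF bil_br] bilinear_lmul[OF bil_br]
  bilinear_rmul[OF bil_br]

lemma Ric_dual:
  "Ric br b x y = - (1/2) * (\<Sum>i\<in>Basis. b (br x i) (br y (dual_vec b i))) +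
     (1/4) * (\<Sum>i\<in>Basis. \<Sum>j\<in>Basis. b (br i j) x * b (br (dual_vec b i) (dual_vec b j)) y)"
  and Ric_orthonormal:
  "orthonormal_basis b F \<Longrightarrow> Ric br b x y = - (1/2) * (\<Sum>e\<in>F. b (br x e) (br y e)) +
     (1/4) * (\<Sum>e\<in>F. \<Sum>e'\<in>F. b (br e e') x * b (br e e') y)"
proof -
  let ?D = "- (1/2) * (\<Sum>i\<in>Basis. b (br x i) (br y (dual_vec b i))) +
     (1/4) * (\<Sum>i\<in>Basis. \<Sum>j\<in>Basis. b (br i j) x * b (br (dual_vec b i) (dual_vec b j)) y)"
  let ?R = "\<lambda>E. - (1/2) * (\<Sum>e\<in>E. b (br x e) (br y e)) +
     (1/4) * (\<Sum>e\<in>E. \<Sum>e'\<in>E. b (br e e') x * b (br e e') y)"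
  have main: "?R E = ?D" if E: "orthonormal_basis b E" for E
  proof -
    have 1: "bilinear (\<lambda>u v. b (br x u) (br y v))"
      unfolding bilinear_def by (simp add: linear_iff bil_simps)
    have 2: "bilinear (\<lambda>u v. \<Sum>j\<in>Basis. b (br u j) x * b (br v (dual_vec b j)) y)"
      unfolding bilinear_def
      by (simp add: linear_iff bil_simps sum.distrib sum_distrib_left algebra_simps)
    have 3: "bilinear (\<lambda>u v. b (br e u) x * b (br e v) y)" for e
      unfolding bilinear_def by (simp add: linear_iff bil_simps algebra_simps)
    show ?thesis
      by (simp only: contraction_orthonormal[OF ip E 1] contraction_orthonormal[OF ip E 2]
          contraction_orthonormal[OF ip E 3])
  qed
  obtain E where E: "orthonormal_basis b E" using orthonormal_basis_exists[OF ip] by blast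
  have "Ric br b x y = ?R (SOME E. orthonormal_basis b E)"
    by (simp add: Ric_def Let_def)
  also have "\<dots> = ?D" by (rule main) (rule someI[of "orthonormal_basis b", OF E])
  finally show R: "Ric br b x y = ?D" .
  show "Ric br b x y = ?R F" if "orthonormal_basis b F" using R main[OF that] by simp
qed

lemma bilinear_Ric: "bilinear (Ric br b)"
proof -
  obtain E where E: "orthonormal_basis b E" using orthonormal_basis_exists[OF ip] by blast
  show ?thesis
    unfolding bilinear_def Ric_orthonormal[OF E]
    by (simp add: linear_iff bil_simps sum.distrib ring_distribs sum_distrib_left
        mult.assoc mult.left_commute add_divide_distrib sum_subtractf sum_negf)
qed

lemma Ric_sym: "Ric br b x y = Ric br b y x"
proof -
  obtain E where E: "orthonormal_basis b E" using orthonormal_basis_exists[OF ip] by blast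
  show ?thesis
    unfolding Ric_orthonormal[OF E] by (simp add: inner_product_sym[OF ip] mult.commute)
qed

lemma Rc: "b (Rc br b x) y = Ric br b x y"
proof -
  have "linear (Ric br b x)" using bilinear_Ric by (auto simp: bilinear_def)
  then obtain z where z: "\<And>y. b z y = Ric br b x y" using riesz_ex[OF ip] by blast
  have "\<forall>y. b (Rc br b x) y = Ric br b x y"
    unfolding Rc_def
    by (rule theI[of _ z]) (auto simp: z intro!: inner_product_nondegenerate[OF ip])
  then show ?thesis by blast
qed

lemma Rc_selfadjoint: "b (Rc br b x) y = b x (Rc br b y)"
  using Rc Ric_sym inner_product_sym[OF ip] by metis

lemma Rc_expand: "Rc br b x = (\<Sum>i\<in>Basis. Ric br b x i *\<^sub>R dual_vec b i)"
  using dual_vec_expand[OF ip, of "Rc br b x"] by (simp add: Rc)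

lemma linear_Rc: "linear (Rc br b)"
  by (rule linearI; rule inner_product_nondegenerate[OF ip])
     (simp_all add: bil_simps Rc bilinear_ladd[OF bilinear_Ric] bilinear_lmul[OF bilinear_Ric])

lemma bilinear_delta:
  assumes T: "linear T" shows "bilinear (delta br T)"
  unfolding bilinear_def delta_def
  by (simp add: linear_iff bil_simps linear_add[OF T] linear_scale[OF T] algebra_simps)

text \<open>
  The moment map identity. Both terms of the Ricci tensor are quadratic in the bracket; traced
  against \<open>T\<close>, the second one is \<open>\<langle>T \<circ> \<mu>, \<mu>\<rangle> / 4\<close>, and the first one is \<open>-\<langle>\<mu>(T \<cdot>, \<cdot>), \<mu>\<rangle> / 2\<close>, which
  by antisymmetry is split evenly between the two arguments of \<open>\<mu>\<close>.
\<close>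

lemma trace_Rc:
  assumes T: "linear T"
  shows "trace_op (Rc br b \<circ> T) = (1/4) * tensor_ip b (delta br T) br"
proof -
  obtain E where E: "orthonormal_basis b E" using orthonormal_basis_exists[OF ip] by blast
  have fin: "finite E" using E by (simp add: orthonormal_basis_def)
  have "trace_op (Rc br b \<circ> T) = (\<Sum>i\<in>Basis. b (Rc br b (T i)) (dual_vec b i))"
    by (simp add: trace_op_def dual_vec_right[OF ip])
  also have "\<dots> = (\<Sum>e\<in>E. b (Rc br b (T e)) e)"
    by (rule contraction_orthonormal[OF ip E])
      (simp add: bilinear_def linear_iff bil_simps linear_add[OF T] linear_scale[OF T]
        linear_add[OF linear_Rc] linear_scale[OF linear_Rc])
  also have "\<dots> = (\<Sum>e\<in>E. Ric br b (T e) e)" by (simp add: Rc)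
  also have "\<dots> = -(1/2) * (\<Sum>e\<in>E. \<Sum>e'\<in>E. b (br (T e) e') (br e e')) +
      (1/4) * (\<Sum>e''\<in>E. \<Sum>e\<in>E. \<Sum>e'\<in>E. b (br e e') (T e'') * b (br e e') e'')"
    by (simp add: Ric_orthonormal[OF E] sum.distrib sum_distrib_left sum_negf sum_subtractf)
  also have "(\<Sum>e''\<in>E. \<Sum>e\<in>E. \<Sum>e'\<in>E. b (br e e') (T e'') * b (br e e') e'')
     = (\<Sum>e\<in>E. \<Sum>e'\<in>E. b (T (br e e')) (br e e'))"
  proof -
    have "b (T v) v = (\<Sum>e''\<in>E. b v (T e'') * b v e'')" for v
    proof -
      have "b (T v) v = b v (T (\<Sum>e''\<in>E. b v e'' *\<^sub>R e''))"
        unfolding orthonormal_expand[OF ip E] by (rule inner_product_sym[OF ip])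
      also have "\<dots> = (\<Sum>e''\<in>E. b v (T e'') * b v e'')"
        using inner_product_linear[OF ip, of v]
        by (simp add: linear_sum[OF T] linear_scale[OF T] linear_sum linear_scale mult.commute)
      finally show ?thesis .
    qed
    then show ?thesis
      by (subst sum.swap) (simp, rule sum.cong[OF refl], rule sum.swap)
  qed
  also have "(\<Sum>e\<in>E. \<Sum>e'\<in>E. b (br (T e) e') (br e e')) =
      (1/2) * ((\<Sum>e\<in>E. \<Sum>e'\<in>E. b (br (T e) e') (br e e')) + (\<Sum>e\<in>E. \<Sum>e'\<in>E. b (br e (T e')) (br e e')))"
  proof -
    have "b (br (T e) e') (br e e') = b (br e' (T e)) (br e' e)" for e e'
      unfolding anti[of "T e" e'] anti[of e e'] by (simp add: bil_simps)
    then have "(\<Sum>e\<in>E. \<Sum>e'\<in>E. b (br (T e) e') (br e e')) = (\<Sum>e'\<in>E. \<Sum>e\<in>E. b (br e' (T e)) (br e' e))"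
      by (subst sum.swap) simp
    then show ?thesis by simp
  qed
  finally show ?thesis
    unfolding tensor_ip_orthonormal[OF ip E bilinear_delta[OF T] bil_br]
    by (simp add: delta_def o_def bil_simps sum.distrib sum_subtractf algebra_simps)
qed

lemma trace_Rc_Rc_nonneg: "0 \<le> trace_op (Rc br b \<circ> Rc br b)"
proof -
  obtain E where E: "orthonormal_basis b E" using orthonormal_basis_exists[OF ip] by blast
  have "trace_op (Rc br b \<circ> Rc br b) = (\<Sum>i\<in>Basis. b (Rc br b i) (Rc br b (dual_vec b i)))"
    by (simp add: trace_op_def dual_vec_right[OF ip] flip: Rc_selfadjoint)
  also have "\<dots> = (\<Sum>e\<in>E. b (Rc br b e) (Rc br b e))"
    by (rule contraction_orthonormal[OF ip E])
      (simp add: bilinear_def linear_iff bil_simps linear_add[OF linear_Rc] linear_scale[OF linear_Rc])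
  also have "\<dots> \<ge> 0" by (intro sum_nonneg inner_product_nonneg[OF ip])
  finally show ?thesis .
qed

end

section \<open>Gram determinants\<close>

definition basis_enum :: "nat \<Rightarrow> 'e::euclidean_space" where
  "basis_enum = (SOME f. bij_betw f {0..<DIM('e)} Basis)"

lemma bij_basis_enum: "bij_betw (basis_enum :: nat \<Rightarrow> 'e::euclidean_space) {0..<DIM('e)} Basis"
  unfolding basis_enum_def
  using someI_ex[OF ex_bij_betw_nat_finite[OF finite_Basis[where 'a='e]]] .

lemma basis_enum_in: "i < DIM('e) \<Longrightarrow> basis_enum i \<in> (Basis :: 'e::euclidean_space set)"
  using bij_basis_enum[where 'e='e] by (auto simp: bij_betw_def)

lemma inner_basis_enum:
  "i < DIM('e) \<Longrightarrow> j < DIM('e) \<Longrightarrow>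
    inner (basis_enum i :: 'e::euclidean_space) (basis_enum j) = (if i = j then 1 else 0)"
  using bij_basis_enum[where 'e='e] basis_enum_in[where 'e='e]
  by (auto simp: inner_Basis bij_betw_def dest: inj_onD)

lemma sum_basis_enum:
  "(\<Sum>k = 0..<DIM('e). f (basis_enum k :: 'e::euclidean_space)) = (\<Sum>i\<in>Basis. f i)"
  using sum.reindex_bij_betw[OF bij_basis_enum] .

definition gram_det :: "('e::euclidean_space \<Rightarrow> 'e \<Rightarrow> real) \<Rightarrow> real" where
  "gram_det Q =
     Determinant.det (Matrix.mat DIM('e) DIM('e) (\<lambda>(i, j). Q (basis_enum i) (basis_enum j)))"

lemma gram_det_cong:
  "(\<And>i j. i \<in> Basis \<Longrightarrow> j \<in> Basis \<Longrightarrow> P i j = Q i j) \<Longrightarrow> gram_det P = gram_det Q"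
  unfolding gram_det_def
  by (intro arg_cong[where f = Determinant.det] eq_matI) (auto simp: basis_enum_in)

lemma gram_det_leibniz:
  fixes Q :: "'e::euclidean_space \<Rightarrow> 'e \<Rightarrow> real"
  shows "gram_det Q = (\<Sum>p | p permutes {0..<DIM('e)}.
     signof p * (\<Prod>i = 0..<DIM('e). Q (basis_enum i) (basis_enum (p i))))"
  unfolding gram_det_def
  by (subst det_def'[of _ "DIM('e)"])
     (auto intro!: sum.cong prod.cong dest: permutes_in_image)

lemma gram_det_mult:
  fixes P Q :: "'e::euclidean_space \<Rightarrow> 'e \<Rightarrow> real"
  shows "gram_det P * gram_det Q = gram_det (\<lambda>x y. \<Sum>k\<in>Basis. P x k * Q k y)"
  unfolding gram_det_def
  by (subst det_mult[symmetric, of _ "DIM('e)"])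
    (auto intro!: arg_cong[where f = Determinant.det] eq_matI
      simp: scalar_prod_def simp flip: sum_basis_enum)

lemma gram_det_inner: "gram_det (inner :: 'e::euclidean_space \<Rightarrow> _) = 1"
proof -
  have "Matrix.mat DIM('e) DIM('e) (\<lambda>(i, j). inner (basis_enum i :: 'e) (basis_enum j)) = 1\<^sub>m DIM('e)"
    by (rule eq_matI) (auto simp: inner_basis_enum)
  then show ?thesis by (simp add: gram_det_def)
qed

text \<open>
  Normalising by the inverse of a Gram matrix: this reduces the derivative of the determinant at a
  general inner product to the derivative at the identity matrix.
\<close>

lemma gram_det_dual_mult:
  fixes b Q :: "'e::euclidean_space \<Rightarrow> 'e \<Rightarrow> real"
  assumes Q: "bilinear Q"
  shows "gram_det (\<lambda>x y. inner (dual_vec b x) y) * gram_det Q = gram_det (\<lambda>x. Q (dual_vec b x))"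
  unfolding gram_det_mult
proof (rule gram_det_cong)
  fix x y :: 'e
  have l: "linear (\<lambda>x. Q x y)" using Q by (auto simp: bilinear_def)
  have "Q (dual_vec b x) y = Q (\<Sum>k\<in>Basis. inner (dual_vec b x) k *\<^sub>R k) y"
    by (simp only: euclidean_representation)
  also have "\<dots> = (\<Sum>k\<in>Basis. inner (dual_vec b x) k * Q k y)"
    by (simp add: linear_sum[OF l] linear_scale[OF l])
  finally show "(\<Sum>k\<in>Basis. inner (dual_vec b x) k * Q k y) = Q (dual_vec b x) y" ..
qed

lemma gram_det_dual:
  assumes b: "inner_product b"
  shows "gram_det (\<lambda>x y. inner (dual_vec b x) y) * gram_det b = 1"
proof -
  have "(\<lambda>x. b (dual_vec b x)) = inner" using dual_vec[OF b] by auto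
  then show ?thesis
    by (simp add: gram_det_dual_mult[OF inner_product_bilinear[OF b]] gram_det_inner)
qed

lemma gram_det_nonzero: "inner_product b \<Longrightarrow> gram_det b \<noteq> 0"
  using gram_det_dual by fastforce

text \<open>
  The factor is the square of the determinant of the matrix of \<open>P\<close>. What matters is that it does not depend on
  the form \<open>Q\<close>.
\<close>

lemma gram_det_congruence:
  fixes P :: "'e::euclidean_space \<Rightarrow> 'e"
  obtains c where "\<And>Q. bilinear Q \<Longrightarrow> gram_det (\<lambda>u v. Q (P u) (P v)) = c * gram_det Q"
proof
  fix Q :: "'e \<Rightarrow> 'e \<Rightarrow> real" assume Q: "bilinear Q"
  have "gram_det (\<lambda>u v. Q (P u) (P v)) =
    gram_det (\<lambda>u v. \<Sum>k\<in>Basis. inner (P u) k * (\<Sum>l\<in>Basis. Q k l * inner (P v) l))"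
    by (rule gram_det_cong, subst bilinear_expand[OF Q])
       (simp add: sum_distrib_left mult_ac)
  also have "\<dots> = gram_det (\<lambda>u k. inner (P u) k) * (gram_det Q * gram_det (\<lambda>l v. inner (P v) l))"
    unfolding gram_det_mult ..
  finally show "gram_det (\<lambda>u v. Q (P u) (P v)) =
      (gram_det (\<lambda>u k. inner (P u) k) * gram_det (\<lambda>l v. inner (P v) l)) * gram_det Q"
    by simp
qed

lemma tendsto_gram_det:
  fixes Q :: "'i \<Rightarrow> 'e::euclidean_space \<Rightarrow> 'e \<Rightarrow> real"
  assumes "\<And>u v. ((\<lambda>i. Q i u v) \<longlongrightarrow> q u v) F"
  shows "((\<lambda>i. gram_det (Q i)) \<longlongrightarrow> gram_det q) F"
  unfolding gram_det_leibniz by (intro tendsto_intros assms)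

text \<open>
  In the Leibniz formula a permutation other than the identity moves at least two indices, so at the
  identity matrix its product keeps a vanishing factor after differentiating one factor. Only the
  diagonal product contributes, and its derivative is the trace.
\<close>

lemma has_derivative_gram_det_inner:
  fixes Q :: "real \<Rightarrow> 'e::euclidean_space \<Rightarrow> 'e \<Rightarrow> real"
  assumes Q: "\<And>u v. ((\<lambda>t. Q t u v) has_real_derivative Q' u v) (at t0)" and 0: "Q t0 = inner"
  shows "((\<lambda>t. gram_det (Q t)) has_real_derivative (\<Sum>i\<in>Basis. Q' i i)) (at t0)"
proof -
  let ?n = "DIM('e)" and ?e = "basis_enum :: nat \<Rightarrow> 'e"
  let ?D = "\<lambda>p. \<Sum>i = 0..<?n. Q' (?e i) (?e (p i)) *
     (\<Prod>j \<in> {0..<?n} - {i}. Q t0 (?e j) (?e (p j)))"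
  have D: "((\<lambda>t. gram_det (Q t)) has_real_derivative
     (\<Sum>p | p permutes {0..<?n}. signof p * ?D p)) (at t0)"
    unfolding gram_det_leibniz
    by (intro DERIV_sum DERIV_cmult has_field_derivative_prod Q)
  have "?D p = 0" if p: "p permutes {0..<?n}" "p \<noteq> id" for p
  proof (rule sum.neutral, rule ballI)
    fix i assume i: "i \<in> {0..<?n}"
    obtain k where k: "p k \<noteq> k" using p(2) by fastforce
    have "\<exists>j. j \<noteq> i \<and> p j \<noteq> j"
    proof (cases "k = i")
      case True
      then have "p i \<noteq> i" using k by simp
      moreover have "p (p i) \<noteq> p i" using permutes_inj[OF p(1)] \<open>p i \<noteq> i\<close> by (auto dest: injD)
      ultimately show ?thesis by blast
    qed (use k in blast)
    then obtain j where j: "j \<noteq> i" "p j \<noteq> j" by blast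
    then have jn: "j < ?n" using permutes_not_in[OF p(1)] by fastforce
    then have pn: "p j < ?n" using permutes_in_image[OF p(1), of j] by simp
    have "Q t0 (?e j) (?e (p j)) = 0" using j jn pn by (simp add: 0 inner_basis_enum)
    then have "(\<Prod>j \<in> {0..<?n} - {i}. Q t0 (?e j) (?e (p j))) = 0"
      using j jn by (auto simp: prod_zero_iff)
    then show "Q' (?e i) (?e (p i)) * (\<Prod>j \<in> {0..<?n} - {i}. Q t0 (?e j) (?e (p j))) = 0" by simp
  qed
  then have "(\<Sum>p | p permutes {0..<?n}. signof p * ?D p) = (\<Sum>p \<in> {id}. signof p * ?D p)"
    by (intro sum.mono_neutral_right) (auto simp: permutes_id finite_permutations)
  also have "\<dots> = (\<Sum>i = 0..<?n. Q' (?e i) (?e i))"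
    by (simp add: 0 inner_basis_enum)
  also have "\<dots> = (\<Sum>i\<in>Basis. Q' i i)" by (rule sum_basis_enum)
  finally show ?thesis using D by simp
qed

lemma has_derivative_gram_det:
  fixes b :: "real \<Rightarrow> 'e::euclidean_space \<Rightarrow> 'e \<Rightarrow> real"
  assumes b: "inner_product (b t0)" and bil: "\<forall>\<^sub>F t in nhds t0. bilinear (b t)"
    and D: "\<And>u v. ((\<lambda>t. b t u v) has_real_derivative b' u v) (at t0)"
  shows "((\<lambda>t. gram_det (b t)) has_real_derivative
     gram_det (b t0) * (\<Sum>i\<in>Basis. b' (dual_vec (b t0) i) i)) (at t0)"
proof -
  let ?d = "gram_det (\<lambda>x y. inner (dual_vec (b t0) x) y)"
  have 1: "?d * gram_det (b t0) = 1" by (rule gram_det_dual[OF b])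
  have 2: "\<forall>\<^sub>F t in nhds t0. ?d * gram_det (b t) = gram_det (\<lambda>x. b t (dual_vec (b t0) x))"
    using bil by eventually_elim (rule gram_det_dual_mult)
  have "(\<lambda>x. b t0 (dual_vec (b t0) x)) = inner" using dual_vec[OF b] by auto
  then have "((\<lambda>t. ?d * gram_det (b t)) has_real_derivative
      (\<Sum>i\<in>Basis. b' (dual_vec (b t0) i) i)) (at t0)"
    by (subst DERIV_cong_ev[OF refl 2 refl]) (intro has_derivative_gram_det_inner D)
  from DERIV_cmult[OF this, of "gram_det (b t0)"] 1
  show ?thesis by (simp add: mult.assoc[symmetric] mult.commute[of _ ?d])
qed

section \<open>Differentiating moving tensors\<close>

text \<open>
  If one factor vanishes at \<open>t0\<close>, continuity of the other one is enough. This is how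
  differentiability of the dual basis is obtained from its continuity alone.
\<close>

lemma has_derivative_vanishing_factor:
  fixes u v :: "real \<Rightarrow> real"
  assumes u: "(u \<longlongrightarrow> u0) (at t0)" and v: "(v has_real_derivative v') (at t0)" and 0: "v t0 = 0"
  shows "((\<lambda>t. u t * v t) has_real_derivative u0 * v') (at t0)"
proof -
  have "((\<lambda>t. u t * ((v t - v t0) / (t - t0))) \<longlongrightarrow> u0 * v') (at t0)"
    using v by (intro tendsto_mult u) (simp add: has_field_derivative_iff)
  then show ?thesis by (simp add: has_field_derivative_iff 0)
qed

lemma inner_has_real_derivative:
  assumes "(u has_vector_derivative u') (at t)"
  shows "((\<lambda>t. inner (u t) k) has_real_derivative inner u' k) (at t)"
  unfolding has_real_derivative_iff_has_vector_derivative
  using bounded_linear.has_vector_derivative[OF bounded_linear_inner_left assms] by simp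

lemma has_vector_derivative_scaleR_const:
  "(u has_real_derivative u') (at t) \<Longrightarrow> ((\<lambda>t. u t *\<^sub>R v) has_vector_derivative u' *\<^sub>R v) (at t)"
  unfolding has_real_derivative_iff_has_vector_derivative
  using bounded_linear.has_vector_derivative[OF bounded_linear_scaleR_left] by blast

lemma has_derivative_moving_form:
  fixes b :: "real \<Rightarrow> 'e::euclidean_space \<Rightarrow> 'e \<Rightarrow> real"
  assumes S: "open S" "t0 \<in> S" and bil: "\<And>t. t \<in> S \<Longrightarrow> bilinear (b t)" and bil': "bilinear b'"
    and D: "\<And>x y. ((\<lambda>t. b t x y) has_real_derivative b' x y) (at t0)"
    and u: "(u has_vector_derivative u') (at t0)" and v: "(v has_vector_derivative v') (at t0)"
  shows "((\<lambda>t. b t (u t) (v t)) has_real_derivative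
     b' (u t0) (v t0) + b t0 u' (v t0) + b t0 (u t0) v') (at t0)"
proof -
  have "((\<lambda>t. \<Sum>i\<in>Basis. \<Sum>j\<in>Basis. inner (u t) i * (inner (v t) j * b t i j)) has_real_derivative
     (\<Sum>i\<in>Basis. \<Sum>j\<in>Basis. inner u' i * (inner (v t0) j * b t0 i j) +
        (inner v' j * b t0 i j + b' i j * inner (v t0) j) * inner (u t0) i)) (at t0)"
    by (intro DERIV_sum DERIV_mult inner_has_real_derivative u v D)
  also have "(\<Sum>i\<in>Basis. \<Sum>j\<in>Basis. inner u' i * (inner (v t0) j * b t0 i j) +
        (inner v' j * b t0 i j + b' i j * inner (v t0) j) * inner (u t0) i) =
      b' (u t0) (v t0) + b t0 u' (v t0) + b t0 (u t0) v'"
    by (simp add: bilinear_expand[OF bil[OF S(2)], of u' "v t0"]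
        bilinear_expand[OF bil[OF S(2)], of "u t0" v'] bilinear_expand[OF bil', of "u t0" "v t0"]
        sum.distrib ring_distribs mult_ac)
  finally show ?thesis
    by (rule has_field_derivative_transform_within_open[OF _ S])
      (subst bilinear_expand[OF bil], simp_all add: mult_ac)
qed

text \<open>
  The resolvent identity \<open>c\<inverse> = b\<inverse> - b\<inverse> (c - b) c\<inverse>\<close> for inverses, in terms of dual vectors.
\<close>

lemma dual_vec_difference:
  fixes b c :: "'e::euclidean_space \<Rightarrow> 'e \<Rightarrow> real"
  assumes b: "inner_product b" and c: "inner_product c"
  shows "dual_vec c x = dual_vec b x -
     (\<Sum>j\<in>Basis. \<Sum>k\<in>Basis. (inner (dual_vec c x) k * (c k j - b k j)) *\<^sub>R dual_vec b j)"
proof -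
  let ?d = "dual_vec c x"
  have l: "linear (\<lambda>x. b x j)" "linear (\<lambda>x. c x j)" for j
    using inner_product_bilinear[OF b] inner_product_bilinear[OF c] by (auto simp: bilinear_def)
  have e: "(\<Sum>k\<in>Basis. inner ?d k * (c k j - b k j)) = inner x j - b ?d j" for j
  proof -
    have "(\<Sum>k\<in>Basis. inner ?d k * (c k j - b k j)) =
       c (\<Sum>k\<in>Basis. inner ?d k *\<^sub>R k) j - b (\<Sum>k\<in>Basis. inner ?d k *\<^sub>R k) j"
      by (simp add: linear_sum[OF l(1)] linear_sum[OF l(2)] linear_scale[OF l(1)]
          linear_scale[OF l(2)] ring_distribs sum_subtractf)
    also have "\<dots> = c ?d j - b ?d j" by (simp only: euclidean_representation)
    finally show ?thesis by (simp add: dual_vec[OF c])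
  qed
  have "(\<Sum>j\<in>Basis. (\<Sum>k\<in>Basis. inner ?d k * (c k j - b k j)) *\<^sub>R dual_vec b j) =
     (\<Sum>j\<in>Basis. b (dual_vec b x) j *\<^sub>R dual_vec b j) - (\<Sum>j\<in>Basis. b ?d j *\<^sub>R dual_vec b j)"
    unfolding e by (simp add: dual_vec[OF b] scaleR_left_diff_distrib sum_subtractf)
  also have "\<dots> = dual_vec b x - ?d" by (simp only: dual_vec_expand[OF b])
  finally show ?thesis by (simp add: scaleR_sum_left)
qed

text \<open>
  The resolvent identity bounds the change of the dual vector by \<open>\<epsilon>(t)\<close> times its current norm,
  where \<open>\<epsilon>(t) \<rightarrow> 0\<close>. Once \<open>\<epsilon>(t) < 1/2\<close> this forces the norm to be at most twice its value at \<open>t0\<close>,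
  and the estimate closes.
\<close>

lemma tendsto_dual_vec:
  fixes b :: "real \<Rightarrow> 'e::euclidean_space \<Rightarrow> 'e \<Rightarrow> real"
  assumes S: "open S" "t0 \<in> S" and ip: "\<And>t. t \<in> S \<Longrightarrow> inner_product (b t)"
    and lim: "\<And>x y. ((\<lambda>t. b t x y) \<longlongrightarrow> b t0 x y) (at t0)"
  shows "((\<lambda>t. dual_vec (b t) x) \<longlongrightarrow> dual_vec (b t0) x) (at t0)"
proof -
  let ?d = "\<lambda>t. dual_vec (b t) x" and ?dual = "dual_vec (b t0)"
  define \<epsilon> where "\<epsilon> t = (\<Sum>j\<in>Basis. \<Sum>k\<in>Basis. \<bar>b t k j - b t0 k j\<bar> * norm (?dual j))" for t
  have "(\<epsilon> \<longlongrightarrow> (\<Sum>j\<in>Basis. \<Sum>k\<in>Basis. \<bar>b t0 k j - b t0 k j\<bar> * norm (?dual j))) (at t0)"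
    unfolding \<epsilon>_def by (intro tendsto_intros lim)
  then have \<epsilon>: "(\<epsilon> \<longlongrightarrow> 0) (at t0)" by simp
  have inS: "\<forall>\<^sub>F t in at t0. t \<in> S" using S by (rule eventually_at_in_open')
  have bound: "norm (?d t - ?d t0) \<le> \<epsilon> t * norm (?d t)" if "t \<in> S" for t
  proof -
    have "norm (?d t - ?d t0) =
      norm (\<Sum>j\<in>Basis. \<Sum>k\<in>Basis. (inner (?d t) k * (b t k j - b t0 k j)) *\<^sub>R ?dual j)"
      by (subst dual_vec_difference[OF ip[OF S(2)] ip[OF that]]) simp
    also have "\<dots> \<le> (\<Sum>j\<in>Basis. \<Sum>k\<in>Basis. norm (?d t) * (\<bar>b t k j - b t0 k j\<bar> * norm (?dual j)))"
      by (intro sum_norm_le) (auto simp: abs_mult mult.assoc Basis_le_norm intro!: mult_right_mono)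
    also have "\<dots> = \<epsilon> t * norm (?d t)"
      unfolding \<epsilon>_def by (simp add: sum_distrib_left sum_distrib_right mult_ac)
    finally show ?thesis .
  qed
  have "\<forall>\<^sub>F t in at t0. \<epsilon> t < 1/2" using order_tendstoD(2)[OF \<epsilon>, of "1/2"] by simp
  then have "\<forall>\<^sub>F t in at t0. norm (?d t - ?d t0) \<le> \<epsilon> t * (2 * norm (?d t0))"
    using inS
  proof eventually_elim
    case (elim t)
    have e0: "\<epsilon> t \<ge> 0" unfolding \<epsilon>_def by (intro sum_nonneg) simp
    have "norm (?d t) \<le> norm (?d t0) + norm (?d t - ?d t0)" by (metis norm_triangle_sub add.commute)
    also have "\<dots> \<le> norm (?d t0) + (1/2) * norm (?d t)"
      using bound[OF elim(2)] mult_right_mono[of "\<epsilon> t" "1/2" "norm (?d t)"] elim(1) by simp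
    finally have "norm (?d t) \<le> 2 * norm (?d t0)" by simp
    then show ?case using bound[OF elim(2)] mult_left_mono[OF _ e0] by (meson order_trans)
  qed
  moreover have "((\<lambda>t. \<epsilon> t * (2 * norm (?d t0))) \<longlongrightarrow> 0) (at t0)"
    using tendsto_mult_left_zero[OF \<epsilon>] .
  ultimately have "((\<lambda>t. ?d t - ?d t0) \<longlongrightarrow> 0) (at t0)" by (rule Lim_null_comparison)
  then show ?thesis by (rule LIM_zero_cancel)
qed

lemma has_derivative_dual_vec:
  fixes b :: "real \<Rightarrow> 'e::euclidean_space \<Rightarrow> 'e \<Rightarrow> real"
  assumes S: "open S" "t0 \<in> S" and ip: "\<And>t. t \<in> S \<Longrightarrow> inner_product (b t)" and bil': "bilinear b'"
    and D: "\<And>x y. ((\<lambda>t. b t x y) has_real_derivative b' x y) (at t0)"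
  shows "((\<lambda>t. dual_vec (b t) x) has_vector_derivative
     - (\<Sum>j\<in>Basis. b' (dual_vec (b t0) x) j *\<^sub>R dual_vec (b t0) j)) (at t0)"
proof -
  let ?d = "\<lambda>t. dual_vec (b t) x" and ?dual = "dual_vec (b t0)"
  have lim: "((\<lambda>t. b t x y) \<longlongrightarrow> b t0 x y) (at t0)" for x y
    using DERIV_isCont[OF D] by (simp add: isCont_def)
  have "((\<lambda>t. ?d t0 - (\<Sum>j\<in>Basis. \<Sum>k\<in>Basis. (inner (?d t) k * (b t k j - b t0 k j)) *\<^sub>R ?dual j))
     has_vector_derivative 0 - (\<Sum>j\<in>Basis. \<Sum>k\<in>Basis. (inner (?d t0) k * (b' k j - 0)) *\<^sub>R ?dual j)) (at t0)"
    by (intro has_vector_derivative_diff has_vector_derivative_const has_vector_derivative_sum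
        has_vector_derivative_scaleR_const has_derivative_vanishing_factor tendsto_intros
        tendsto_dual_vec[OF S ip lim] DERIV_diff D DERIV_const) auto
  then have "(?d has_vector_derivative
      0 - (\<Sum>j\<in>Basis. \<Sum>k\<in>Basis. (inner (?d t0) k * (b' k j - 0)) *\<^sub>R ?dual j)) (at t0)"
    by (rule has_vector_derivative_transform_within_open[OF _ S])
       (rule dual_vec_difference[OF ip[OF S(2)] ip, symmetric])
  moreover have "(\<Sum>k\<in>Basis. inner z k * b' k j) = b' z j" for z j
  proof -
    have l: "linear (\<lambda>x. b' x j)" using bil' by (auto simp: bilinear_def)
    have "(\<Sum>k\<in>Basis. inner z k * b' k j) = b' (\<Sum>k\<in>Basis. inner z k *\<^sub>R k) j"
      by (simp add: linear_sum[OF l] linear_scale[OF l])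
    then show ?thesis by (simp only: euclidean_representation)
  qed
  ultimately show ?thesis by (simp flip: scaleR_sum_left)
qed

section \<open>The Ricci flow of inner products on a Lie algebra\<close>

text \<open>
  Invariance reduces the Ricci flow of invariant metrics to an ordinary differential equation for
  inner products on a fixed Lie algebra.
\<close>

locale algebraic_ricci_flow =
  fixes br :: "'e::euclidean_space \<Rightarrow> 'e \<Rightarrow> 'e" and b :: "real \<Rightarrow> 'e \<Rightarrow> 'e \<Rightarrow> real"
  assumes bil_br: "bilinear br" and anti: "br x y = - br y x"
    and ip: "0 < t \<Longrightarrow> inner_product (b t)"
    and flow: "0 < t \<Longrightarrow> ((\<lambda>t. b t x y) has_real_derivative - 2 * Ric br (b t) x y) (at t)"
begin

abbreviation d where "d t \<equiv> dual_vec (b t)"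
abbreviation R where "R t \<equiv> Rc br (b t)"

lemma static: "0 < t \<Longrightarrow> metric_bracket (b t) br"
  by unfold_locales (assumption | rule ip bil_br anti)+

lemma bil: "0 < t \<Longrightarrow> bilinear (b t)" by (rule metric_bracket.bil[OF static])

lemma positive_times: "open {0::real<..}" "0 < t \<Longrightarrow> t \<in> {0<..}" for t :: real
  by auto

lemma bilinear_flow: "0 < t \<Longrightarrow> bilinear (\<lambda>x y. - 2 * Ric br (b t) x y)"
  unfolding bilinear_def linear_iff
  using bilinear_ladd[OF metric_bracket.bilinear_Ric[OF static]]
    bilinear_radd[OF metric_bracket.bilinear_Ric[OF static]]
    bilinear_lmul[OF metric_bracket.bilinear_Ric[OF static]]
    bilinear_rmul[OF metric_bracket.bilinear_Ric[OF static]]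
  by (simp add: ring_distribs)

lemma has_derivative_form:
  assumes t: "0 < t"
    and u: "(u has_vector_derivative u') (at t)" and v: "(v has_vector_derivative v') (at t)"
  shows "((\<lambda>t. b t (u t) (v t)) has_real_derivative
     - 2 * Ric br (b t) (u t) (v t) + b t u' (v t) + b t (u t) v') (at t)"
  using t by (intro has_derivative_moving_form[OF positive_times bil bilinear_flow flow u v]) auto

lemma has_derivative_d:
  assumes t: "0 < t"
  shows "((\<lambda>t. d t x) has_vector_derivative 2 *\<^sub>R R t (d t x)) (at t)"
proof -
  have "((\<lambda>t. d t x) has_vector_derivative
     - (\<Sum>j\<in>Basis. (- 2 * Ric br (b t) (d t x) j) *\<^sub>R d t j)) (at t)"
    using t by (intro has_derivative_dual_vec[OF positive_times ip bilinear_flow flow]) auto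
  also have "- (\<Sum>j\<in>Basis. (- 2 * Ric br (b t) (d t x) j) *\<^sub>R d t j) = 2 *\<^sub>R R t (d t x)"
    unfolding metric_bracket.Rc_expand[OF static[OF t]] scaleR_sum_right sum_negf[symmetric]
    by (intro sum.cong refl) simp
  finally show ?thesis .
qed

lemma has_derivative_br:
  assumes u: "(u has_vector_derivative u') (at t)" and v: "(v has_vector_derivative v') (at t)"
  shows "((\<lambda>t. br (u t) (v t)) has_vector_derivative br (u t) v' + br u' (v t)) (at t)"
  by (rule bounded_bilinear.has_vector_derivative[OF
        bil_br[unfolded bilinear_conv_bounded_bilinear] u v])

text \<open>
  The inner product of tensors varies through \<open>b\<close> itself, with derivative \<open>-2 b(Rc \<cdot>, \<cdot>)\<close>, and
  through the dual vectors in the arguments of the second tensor, with derivative \<open>2 Rc\<close>. For the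
  constant tensor \<open>br\<close> the three terms combine to \<open>-2 \<delta>(Rc)\<close>.
\<close>

lemma has_derivative_tensor_ip:
  assumes t: "0 < t" and P: "\<And>x y. ((\<lambda>t. P t x y) has_vector_derivative P' x y) (at t)"
  shows "((\<lambda>t. tensor_ip (b t) (P t) br) has_real_derivative
     - 2 * tensor_ip (b t) (P t) (delta br (R t)) + tensor_ip (b t) P' br) (at t)"
proof -
  interpret metric_bracket "b t" br by (rule static[OF t])
  have D: "((\<lambda>t. tensor_ip (b t) (P t) br) has_real_derivative
     (\<Sum>i\<in>Basis. \<Sum>j\<in>Basis. - 2 * Ric br (b t) (P t i j) (br (d t i) (d t j)) +
        b t (P' i j) (br (d t i) (d t j)) +
        b t (P t i j) (br (d t i) (2 *\<^sub>R R t (d t j)) + br (2 *\<^sub>R R t (d t i)) (d t j)))) (at t)"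
    unfolding tensor_ip_def
    by (intro DERIV_sum has_derivative_form[OF t P] has_derivative_br has_derivative_d t)
  have Ric: "Ric br (b t) x y = b t x (R t y)" for x y using Rc Rc_selfadjoint by simp
  note D
  also have "(\<Sum>i\<in>Basis. \<Sum>j\<in>Basis. - 2 * Ric br (b t) (P t i j) (br (d t i) (d t j)) +
        b t (P' i j) (br (d t i) (d t j)) +
        b t (P t i j) (br (d t i) (2 *\<^sub>R R t (d t j)) + br (2 *\<^sub>R R t (d t i)) (d t j))) =
      - 2 * tensor_ip (b t) (P t) (delta br (R t)) + tensor_ip (b t) P' br"
    unfolding tensor_ip_def
    unfolding sum_distrib_left sum.distrib[symmetric]
    by (intro sum.cong refl)
      (simp only: delta_def Ric bil_simps, simp)
  finally show ?thesis .
qed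

text \<open>
  The derivative \<open>R'\<close> is left abstract, because its contribution to the derivative of \<open>tr (Rc\<^sup>2)\<close>
  will be eliminated by the moment map identity. Linearity of \<open>R'\<close> is what that identity asks for.
\<close>

lemma Rc_differentiable:
  assumes t: "0 < t"
  obtains R' where "linear R'" "\<And>x. ((\<lambda>t. R t x) has_vector_derivative R' x) (at t)"
proof -
  have form: "(\<lambda>t. b t (u t) (v t)) differentiable (at t)"
    if "u differentiable (at t)" "v differentiable (at t)" for u v
    using has_derivative_form[OF t that[unfolded vector_derivative_works]]
    unfolding real_differentiable_def by (rule exI)
  have brd: "(\<lambda>t. br (u t) (v t)) differentiable (at t)"
    if "u differentiable (at t)" "v differentiable (at t)" for u v
    by (rule differentiableI_vector[OF has_derivative_br[OF that[unfolded vector_derivative_works]]])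
  have dd: "(\<lambda>t. d t x) differentiable (at t)" for x
    by (rule differentiableI_vector[OF has_derivative_d[OF t]])
  let ?F = "\<lambda>x t. \<Sum>k\<in>Basis. (- (1/2) * (\<Sum>i\<in>Basis. b t (br x i) (br k (d t i))) +
     (1/4) * (\<Sum>i\<in>Basis. \<Sum>j\<in>Basis. b t (br i j) x * b t (br (d t i) (d t j)) k)) *\<^sub>R d t k"
  have F: "R t x = ?F x t" if "0 < t" for t x
    using metric_bracket.Rc_expand[OF static[OF that], of x]
    by (simp only: metric_bracket.Ric_dual[OF static[OF that]])
  have "?F x differentiable (at t)" for x
    by (intro differentiable_sum ballI differentiable_scaleR differentiable_add differentiable_mult
        form brd dd differentiable_const finite_Basis)
  then have "(?F x has_vector_derivative vector_derivative (?F x) (at t)) (at t)" for x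
    unfolding vector_derivative_works .
  then have D: "((\<lambda>t. R t x) has_vector_derivative vector_derivative (?F x) (at t)) (at t)" for x
    by (rule has_vector_derivative_transform_within_open[OF _ positive_times])
       (use t in \<open>simp_all only: F greaterThan_iff\<close>)
  define R' where "R' x = (\<Sum>i\<in>Basis. inner x i *\<^sub>R vector_derivative (?F i) (at t))" for x
  have "linear R'"
    unfolding R'_def linear_iff
    by (simp add: inner_add_left scaleR_left_distrib sum.distrib scaleR_sum_right)
  moreover have "((\<lambda>t. R t x) has_vector_derivative R' x) (at t)" for x
  proof -
    have "((\<lambda>t. \<Sum>i\<in>Basis. inner x i *\<^sub>R R t i) has_vector_derivative R' x) (at t)"
      unfolding R'_def
      by (intro has_vector_derivative_sum
          bounded_linear.has_vector_derivative[OF bounded_linear_scaleR_right D])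
    then show ?thesis
    proof (rule has_vector_derivative_transform_within_open[OF _ positive_times])
      show "0 < t" by fact
      fix s :: real assume "s \<in> {0<..}"
      then have l: "linear (R s)" using metric_bracket.linear_Rc[OF static] by simp
      have "(\<Sum>i\<in>Basis. inner x i *\<^sub>R R s i) = R s (\<Sum>i\<in>Basis. inner x i *\<^sub>R i)"
        by (simp add: linear_sum[OF l] linear_scale[OF l])
      then show "(\<Sum>i\<in>Basis. inner x i *\<^sub>R R s i) = R s x" by (simp only: euclidean_representation)
    qed
  qed
  ultimately show ?thesis by (rule that)
qed

definition bracket_energy :: "real \<Rightarrow> real" where
  "bracket_energy t = tensor_ip (b t) br br"

definition Ric_energy :: "real \<Rightarrow> real" where
  "Ric_energy t = trace_op (R t \<circ> R t)"

lemma bracket_energy_nonneg: "0 < t \<Longrightarrow> 0 \<le> bracket_energy t"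
  unfolding bracket_energy_def by (rule tensor_ip_nonneg[OF ip bil_br])

lemma tensor_ip_delta_Rc:
  assumes t: "0 < t"
  shows "tensor_ip (b t) (delta br (R t)) br = 4 * Ric_energy t"
  using metric_bracket.trace_Rc[OF static[OF t] metric_bracket.linear_Rc[OF static[OF t]]]
  by (simp add: Ric_energy_def)

lemma has_derivative_bracket_energy:
  assumes t: "0 < t"
  shows "(bracket_energy has_real_derivative - 8 * Ric_energy t) (at t)"
proof -
  interpret metric_bracket "b t" br by (rule static[OF t])
  have "(bracket_energy has_real_derivative
     - 2 * tensor_ip (b t) br (delta br (R t)) + tensor_ip (b t) (\<lambda>x y. 0) br) (at t)"
    unfolding bracket_energy_def by (intro has_derivative_tensor_ip t has_vector_derivative_const)
  moreover have "tensor_ip (b t) (\<lambda>x y. 0) br = 0"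
    by (simp add: tensor_ip_def bilinear_lzero[OF bil])
  moreover have "tensor_ip (b t) br (delta br (R t)) = 4 * Ric_energy t"
    using tensor_ip_delta_Rc[OF t] tensor_ip_sym[OF ip bil_br bilinear_delta[OF linear_Rc]]
    by simp
  ultimately show ?thesis by simp
qed

text \<open>
  Let \<open>R'\<close> be the derivative of \<open>R = Rc\<close>, and \<open>N = tr (R\<^sup>2)\<close>. Directly, \<open>N' = 2 tr (R R')\<close>. From
  \<open>4 N = \<langle>\<delta>(R), \<mu>\<rangle>\<close> one finds \<open>4 N' = -2 |\<delta>(R)|\<^sup>2 + \<langle>\<delta>(R'), \<mu>\<rangle>\<close>, where the last term is \<open>4 tr (R R')\<close>
  by the moment map identity applied to \<open>R'\<close>, that is \<open>2 N'\<close>. Comparison gives \<open>N' = -|\<delta>(R)|\<^sup>2\<close>.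
\<close>

lemma has_derivative_Ric_energy:
  assumes t: "0 < t"
  shows "(Ric_energy has_real_derivative - tensor_ip (b t) (delta br (R t)) (delta br (R t))) (at t)"
proof -
  interpret metric_bracket "b t" br by (rule static[OF t])
  obtain R' where R': "linear R'" "\<And>x. ((\<lambda>t. R t x) has_vector_derivative R' x) (at t)"
    using Rc_differentiable[OF t] by blast
  have comp: "inner (f (g i)) i = (\<Sum>k\<in>Basis. inner (g i) k * inner (f k) i)"
    if f: "linear f" for f g :: "'e \<Rightarrow> 'e" and i
  proof -
    have "inner (f (g i)) i = inner (f (\<Sum>k\<in>Basis. inner (g i) k *\<^sub>R k)) i"
      by (simp only: euclidean_representation)
    then show ?thesis by (simp add: linear_sum[OF f] linear_scale[OF f] inner_sum_left)
  qed
  let ?T = "\<Sum>i\<in>Basis. \<Sum>k\<in>Basis. inner (R' i) k * inner (R t k) i"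
  have T: "trace_op (R t \<circ> R') = ?T"
    by (simp add: trace_op_def comp[OF linear_Rc])
  have N: "(\<Sum>i\<in>Basis. \<Sum>k\<in>Basis. inner (R t i) k * inner (R t k) i) = Ric_energy t" if "0 < t" for t
    by (simp add: Ric_energy_def trace_op_def comp[OF metric_bracket.linear_Rc[OF static[OF that]]])
  have "((\<lambda>t. \<Sum>i\<in>Basis. \<Sum>k\<in>Basis. inner (R t i) k * inner (R t k) i) has_real_derivative
    (\<Sum>i\<in>Basis. \<Sum>k\<in>Basis. inner (R' i) k * inner (R t k) i + inner (R' k) i * inner (R t i) k)) (at t)"
    by (intro DERIV_sum DERIV_mult inner_has_real_derivative R')
  then have "(Ric_energy has_real_derivative
    (\<Sum>i\<in>Basis. \<Sum>k\<in>Basis. inner (R' i) k * inner (R t k) i + inner (R' k) i * inner (R t i) k)) (at t)"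
    by (rule has_field_derivative_transform_within_open[OF _ positive_times])
       (use t N in auto)
  also have "(\<Sum>i\<in>Basis. \<Sum>k\<in>Basis. inner (R' i) k * inner (R t k) i + inner (R' k) i * inner (R t i) k)
     = 2 * ?T"
    by (simp add: sum.distrib) (rule sum.swap)
  finally have D1: "(Ric_energy has_real_derivative 2 * ?T) (at t)" .
  have "((\<lambda>t. delta br (R t) x y) has_vector_derivative delta br R' x y) (at t)" for x y
    using has_derivative_br[OF R'(2)[of x] has_vector_derivative_const[of y]]
      has_derivative_br[OF has_vector_derivative_const[of x] R'(2)[of y]]
    unfolding delta_def
    by (intro has_vector_derivative_diff R'(2))
      (simp_all add: bilinear_lzero[OF bil_br] bilinear_rzero[OF bil_br])
  note D = has_derivative_tensor_ip[where P = "\<lambda>t. delta br (R t)" and P' = "delta br R'", OF t this]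
  have "tensor_ip (b t) (delta br R') br = 4 * ?T" using trace_Rc[OF R'(1)] T by simp
  with D have "((\<lambda>t. tensor_ip (b t) (delta br (R t)) br) has_real_derivative
     - 2 * tensor_ip (b t) (delta br (R t)) (delta br (R t)) + 4 * ?T) (at t)"
    by simp
  then have D2: "((\<lambda>t. 4 * Ric_energy t) has_real_derivative
     - 2 * tensor_ip (b t) (delta br (R t)) (delta br (R t)) + 4 * ?T) (at t)"
    by (rule has_field_derivative_transform_within_open[OF _ positive_times])
       (use t tensor_ip_delta_Rc in auto)
  from DERIV_unique[OF D2 DERIV_cmult[OF D1, of 4]]
  have "2 * ?T = - tensor_ip (b t) (delta br (R t)) (delta br (R t))" by simp
  then show ?thesis using D1 by simp
qed

text \<open>
  The square makes the logarithm differentiable without knowing the sign of the determinant, and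
  normalises the derivative to be exactly \<open>bracket_energy\<close>.
\<close>

definition log_det :: "real \<Rightarrow> real" where
  "log_det t = ln ((gram_det (b t))\<^sup>2)"

lemma has_derivative_log_det:
  assumes t: "0 < t"
  shows "(log_det has_real_derivative bracket_energy t) (at t)"
proof -
  have ev: "\<forall>\<^sub>F s in nhds t. bilinear (b s)"
    by (rule eventually_mono[OF eventually_nhds_in_open[OF positive_times]])
       (use t bil in auto)
  interpret metric_bracket "b t" br by (rule static[OF t])
  let ?g = "gram_det (b t)"
  have g: "?g \<noteq> 0" by (rule gram_det_nonzero[OF ip])
  have "Ric br (b t) (d t i) i = inner (R t i) i" for i
    using Ric_sym Rc dual_vec_right[OF ip] by metis
  then have "(\<Sum>i\<in>Basis. Ric br (b t) (d t i) i) = trace_op (R t \<circ> id)"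
    by (simp add: trace_op_def)
  also have "\<dots> = - bracket_energy t / 4"
  proof -
    have "delta br id = (\<lambda>x y. - br x y)" by (simp add: delta_def fun_eq_iff)
    then show ?thesis
      by (subst trace_Rc) (simp_all add: linear_id bracket_energy_def tensor_ip_def bil_simps sum_negf)
  qed
  finally have tr: "(\<Sum>i\<in>Basis. - 2 * Ric br (b t) (d t i) i) = bracket_energy t / 2"
    by (simp add: sum_negf flip: sum_distrib_left)
  have D: "((\<lambda>t. gram_det (b t)) has_real_derivative ?g * (bracket_energy t / 2)) (at t)"
    using has_derivative_gram_det[OF ip ev flow[OF t]] unfolding tr .
  have "(log_det has_real_derivative 1 / ?g\<^sup>2 * (2 * ?g * (?g * (bracket_energy t / 2)))) (at t)"
    unfolding log_det_def using g
    by (auto intro!: derivative_eq_intros D)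
  also have "1 / ?g\<^sup>2 * (2 * ?g * (?g * (bracket_energy t / 2))) = bracket_energy t"
    using g by (simp add: power2_eq_square)
  finally show ?thesis .
qed

end

section \<open>Asymptotics of the flow\<close>

text \<open>
  Monotone convergence for functions of a real variable, to be applied to the slope of a concave
  function.
\<close>

lemma antimono_tendsto_at_top:
  fixes k :: "real \<Rightarrow> real"
  assumes anti: "\<And>x y. a \<le> x \<Longrightarrow> x \<le> y \<Longrightarrow> k y \<le> k x" and low: "\<And>x. a \<le> x \<Longrightarrow> 0 \<le> k x"
  obtains L where "0 \<le> L" "(k \<longlongrightarrow> L) at_top"
proof
  define L where "L = Inf (k ` {a..})"
  have bdd: "bdd_below (k ` {a..})" using low by (auto intro!: bdd_belowI2)
  show "0 \<le> L" unfolding L_def using low by (intro cINF_greatest) auto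
  show "(k \<longlongrightarrow> L) at_top"
  proof (rule order_tendstoI)
    fix y assume "y < L"
    moreover have "L \<le> k x" if "a \<le> x" for x
      unfolding L_def using that by (intro cINF_lower bdd) auto
    ultimately have "y < k x" if "a \<le> x" for x using that by fastforce
    then show "\<forall>\<^sub>F x in at_top. y < k x" by (rule eventually_at_top_linorderI)
  next
    fix y assume "L < y"
    then obtain x where x: "a \<le> x" "k x < y"
      unfolding L_def by (subst (asm) cInf_less_iff) (use bdd in auto)
    have "k z < y" if "x \<le> z" for z using anti[OF x(1) that] x by simp
    then show "\<forall>\<^sub>F x in at_top. k x < y" by (rule eventually_at_top_linorderI)
  qed
qed

context algebraic_ricci_flow
begin

lemma bracket_energy_zero:
  assumes "0 < t" "bracket_energy t = 0"
  shows "br x y = 0"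
  using tensor_ip_eq_0[OF ip bil_br] assms by (simp add: bracket_energy_def)

text \<open>
  Cauchy's mean value theorem for \<open>log_det\<close> against \<open>ln\<close>.
\<close>

lemma log_det_mean_value:
  assumes "0 < x" "0 < y"
  obtains z where "min x y \<le> z" "log_det y - log_det x = (ln y - ln x) * (z * bracket_energy z)"
proof -
  have main: "\<exists>z\<ge>x. log_det y - log_det x = (ln y - ln x) * (z * bracket_energy z)"
    if "0 < x" "x < y" for x y
  proof -
    have "\<exists>z. x < z \<and> z < y \<and> (log_det y - log_det x) * (1 / z) = (ln y - ln x) * bracket_energy z"
    proof (rule GMVT'[OF that(2)])
      fix z assume "x \<le> z"
      then have z: "0 < z" using that(1) by simp
      show "isCont log_det z" by (rule DERIV_isCont[OF has_derivative_log_det[OF z]])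
      show "isCont ln z" by (rule DERIV_isCont[OF DERIV_ln[OF z]])
    next
      fix z assume "x < z"
      then have z: "0 < z" using that(1) by simp
      show "(log_det has_real_derivative bracket_energy z) (at z)" by (rule has_derivative_log_det[OF z])
      show "(ln has_real_derivative 1 / z) (at z)" using DERIV_ln[OF z] by (simp add: field_simps)
    qed
    then obtain z where z: "x < z" "(log_det y - log_det x) * (1 / z) = (ln y - ln x) * bracket_energy z"
      by blast
    have "log_det y - log_det x = (log_det y - log_det x) * (1 / z) * z" using z(1) that(1) by simp
    also have "\<dots> = (ln y - ln x) * (z * bracket_energy z)" unfolding z(2) by simp
    finally show ?thesis using z(1) by (intro exI[of _ z]) simp
  qed
  consider "x < y" | "y < x" | "x = y" by linarith
  then show ?thesis
  proof cases
    case 1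
    then show ?thesis using main[OF assms(1) 1] that by auto
  next
    case 2
    then obtain z where "y \<le> z" "log_det x - log_det y = (ln x - ln y) * (z * bracket_energy z)"
      using main[OF assms(2) 2] by auto
    then show ?thesis using 2 by (intro that[of z]) (auto simp: algebra_simps)
  next
    case 3
    then show ?thesis using that[of x] by simp
  qed
qed

text \<open>
  The slope \<open>k\<close> of \<open>1/f\<close> has derivative \<open>(128 N\<^sup>2 - 8 |\<delta>(Rc)|\<^sup>2 f) / f\<^sup>3 \<le> 0\<close> by the Cauchy--Schwarz
  inequality, so \<open>1/f\<close> is concave. Its slope is decreasing, and nonnegative
  because \<open>N = tr (Rc\<^sup>2)\<close> is the squared norm of a self-adjoint operator; hence it converges, and by
  l'Hospital's rule \<open>1/f(t)\<close> divided by \<open>t\<close> has the same limit.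
\<close>

lemma inverse_energy_sublinear:
  assumes pos: "\<And>t. 0 < t \<Longrightarrow> 0 < bracket_energy t"
  obtains L where "0 \<le> L" "((\<lambda>t. (1 / bracket_energy t) / t) \<longlongrightarrow> L) at_top"
proof -
  let ?f = bracket_energy and ?N = Ric_energy
  define k where "k t = 8 * ?N t / (?f t)\<^sup>2" for t
  define M where "M t = tensor_ip (b t) (delta br (R t)) (delta br (R t))" for t
  have h: "((\<lambda>t. 1 / ?f t) has_real_derivative k t) (at t)" if "0 < t" for t
    using pos[OF that] that unfolding k_def
    by (auto intro!: derivative_eq_intros has_derivative_bracket_energy simp: power2_eq_square)
  have k: "(k has_real_derivative (128 * (?N t)\<^sup>2 - 8 * M t * ?f t) / (?f t) ^ 3) (at t)" if "0 < t" for t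
    using pos[OF that] that unfolding k_def M_def
    by (auto intro!: derivative_eq_intros has_derivative_bracket_energy has_derivative_Ric_energy
      simp: field_simps power2_eq_square power3_eq_cube)
  have CS: "128 * (?N t)\<^sup>2 \<le> 8 * M t * ?f t" if "0 < t" for t
  proof -
    interpret metric_bracket "b t" br by (rule static[OF that])
    have "(4 * ?N t)\<^sup>2 \<le> M t * ?f t"
      using tensor_ip_Cauchy_Schwarz[OF ip bilinear_delta[OF linear_Rc] bil_br] pos[OF that]
        tensor_ip_delta_Rc[OF that] by (simp add: M_def bracket_energy_def)
    then show ?thesis by (simp add: power2_eq_square)
  qed
  have anti: "k y \<le> k x" if "1 \<le> x" "x \<le> y" for x y
  proof (rule DERIV_nonpos_imp_nonincreasing[OF that(2)])
    fix z assume "x \<le> z" "z \<le> y"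
    then have z: "0 < z" using that by simp
    have "(128 * (?N z)\<^sup>2 - 8 * M z * ?f z) / (?f z) ^ 3 \<le> 0"
      using CS[OF z] pos[OF z] by (intro divide_nonpos_pos) auto
    then show "\<exists>y. (k has_real_derivative y) (at z) \<and> y \<le> 0" using k[OF z] by blast
  qed
  have nonneg: "0 \<le> k t" if "1 \<le> t" for t
    unfolding k_def Ric_energy_def
    using that metric_bracket.trace_Rc_Rc_nonneg[OF static, of t] by simp
  obtain L where L: "0 \<le> L" "(k \<longlongrightarrow> L) at_top"
    using antimono_tendsto_at_top[of 1 k] anti nonneg by blast
  have "((\<lambda>t. (1 / ?f t) / t) \<longlongrightarrow> L) at_top"
  proof (rule lhospital_at_top_at_top[where f' = k and g' = "\<lambda>_. 1"])
    show "\<forall>\<^sub>F t in at_top. ((\<lambda>t. 1 / ?f t) has_real_derivative k t) (at t)"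
      using eventually_gt_at_top[of 0] by eventually_elim (rule h)
  qed (use L in \<open>auto simp: filterlim_ident\<close>)
  then show ?thesis using L(1) that by blast
qed

text \<open>
  The difference is \<open>ln t\<close> times a value of \<open>z f(z)\<close> at some \<open>z\<close> between \<open>s i\<close> and \<open>s i * t\<close>. If \<open>1/f\<close>
  has positive asymptotic slope \<open>L\<close>, then \<open>z f(z)\<close> tends to \<open>c = 1/L\<close>; if \<open>L = 0\<close>, it tends to infinity,
  which contradicts the convergence for \<open>t = 2\<close>. If \<open>f\<close> vanishes somewhere, the bracket is zero and
  \<open>c = 0\<close>.
\<close>

lemma log_det_blowdown:
  assumes s: "\<And>i. 0 < s i" "filterlim s at_top sequentially"
    and lim: "\<And>t. 0 < t \<Longrightarrow> (\<lambda>i. log_det (s i * t) - log_det (s i)) \<longlonglongrightarrow> l t"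
  obtains c where "\<And>t. 0 < t \<Longrightarrow> l t = c * ln t"
proof (cases "\<exists>t>0. bracket_energy t = 0")
  case True
  then have "br x y = 0" for x y using bracket_energy_zero by blast
  then have *: "bracket_energy t = 0" if "0 < t" for t
    using that bilinear_lzero[OF bil] by (simp add: bracket_energy_def tensor_ip_def)
  have "log_det (s i * t) - log_det (s i) = 0" if "0 < t" for i t
  proof -
    have st: "0 < s i * t" using s(1)[of i] that by simp
    obtain z where z: "min (s i) (s i * t) \<le> z"
        "log_det (s i * t) - log_det (s i) = (ln (s i * t) - ln (s i)) * (z * bracket_energy z)"
      by (rule log_det_mean_value[OF s(1) st])
    have "0 < z" using z(1) st s(1)[of i] by linarith
    then show ?thesis using z(2) * by simp
  qed
  then have "(\<lambda>i. log_det (s i * t) - log_det (s i)) = (\<lambda>i. 0)" if "0 < t" for t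
    using that by blast
  then have "l t = 0" if "0 < t" for t
    using lim[OF that] that LIMSEQ_unique[OF _ tendsto_const] by metis
  then show ?thesis using that[of 0] by simp
next
  case False
  then have pos: "0 < bracket_energy t" if "0 < t" for t
    using bracket_energy_nonneg[OF that] that by (metis order_le_less)
  obtain L where L: "0 \<le> L" "((\<lambda>t. (1 / bracket_energy t) / t) \<longlongrightarrow> L) at_top"
    using inverse_energy_sublinear[OF pos] by blast
  have ex: "\<exists>\<xi>. filterlim \<xi> at_top sequentially \<and>
      (\<forall>i. log_det (s i * t) - log_det (s i) = ln t * (\<xi> i * bracket_energy (\<xi> i)))" if t: "0 < t" for t
  proof -
    have "\<exists>z. min (s i) (s i * t) \<le> z \<and>
        log_det (s i * t) - log_det (s i) = ln t * (z * bracket_energy z)" for i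
    proof -
      have e: "ln (s i * t) - ln (s i) = ln t" using ln_mult_pos[OF s(1)[of i] t] by linarith
      obtain z where z: "min (s i) (s i * t) \<le> z"
        "log_det (s i * t) - log_det (s i) = (ln (s i * t) - ln (s i)) * (z * bracket_energy z)"
        by (rule log_det_mean_value[OF s(1) mult_pos_pos[OF s(1) t]])
      show ?thesis by (rule exI[of _ z], rule conjI[OF z(1) z(2)[unfolded e]])
    qed
    then have "\<forall>i. \<exists>z. min (s i) (s i * t) \<le> z \<and>
        log_det (s i * t) - log_det (s i) = ln t * (z * bracket_energy z)" by (rule allI)
    from choice[OF this] obtain \<xi> where "\<forall>i. min (s i) (s i * t) \<le> \<xi> i \<and>
        log_det (s i * t) - log_det (s i) = ln t * (\<xi> i * bracket_energy (\<xi> i))" ..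
    note \<xi> = this[rule_format, THEN conjunct1] this[rule_format, THEN conjunct2]
    have le: "s i * min 1 t \<le> \<xi> i" for i
    proof (cases "t \<le> 1")
      case True
      have "s i * t \<le> s i * 1" by (rule mult_left_mono[OF True less_imp_le[OF s(1)]])
      then have "s i * t \<le> s i" by (simp only: mult_1_right)
      from \<xi>(1)[of i, unfolded min_absorb2[OF this]] show ?thesis
        unfolding min_absorb2[OF True] .
    next
      case False
      then have t1: "1 \<le> t" by linarith
      have "s i * 1 \<le> s i * t" by (rule mult_left_mono[OF t1 less_imp_le[OF s(1)]])
      then have "s i \<le> s i * t" by (simp only: mult_1_right)
      from \<xi>(1)[of i, unfolded min_absorb1[OF this]] show ?thesis
        unfolding min_absorb1[OF t1] mult_1_right .
    qed
    have "filterlim (\<lambda>i. s i * min 1 t) at_top sequentially"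
      by (rule filterlim_at_top_mult_tendsto_pos[OF tendsto_const _ s(2)]) (use t in simp)
    then have "filterlim \<xi> at_top sequentially"
      by (rule filterlim_at_top_mono) (simp add: le)
    then show ?thesis using \<xi>(2) by (intro exI[of _ \<xi>] conjI allI)
  qed
  have recip: "inverse ((1 / bracket_energy t) / t) = t * bracket_energy t" for t by simp
  show ?thesis
  proof (cases "L = 0")
    case False
    have "((\<lambda>t. inverse ((1 / bracket_energy t) / t)) \<longlongrightarrow> inverse L) at_top"
      by (intro tendsto_inverse L False)
    then have q: "((\<lambda>t. t * bracket_energy t) \<longlongrightarrow> inverse L) at_top" by (simp only: recip)
    show ?thesis
    proof (rule that[of "inverse L"])
      fix t :: real assume t: "0 < t"
      obtain \<xi> where \<xi>: "filterlim \<xi> at_top sequentially"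
        "\<And>i. log_det (s i * t) - log_det (s i) = ln t * (\<xi> i * bracket_energy (\<xi> i))"
        using ex[OF t] by blast
      have "(\<lambda>i. ln t * (\<xi> i * bracket_energy (\<xi> i))) \<longlonglongrightarrow> ln t * inverse L"
        by (intro tendsto_mult tendsto_const filterlim_compose[OF q \<xi>(1)])
      then have "(\<lambda>i. log_det (s i * t) - log_det (s i)) \<longlonglongrightarrow> inverse L * ln t"
        by (simp only: \<xi>(2) mult.commute[of "inverse L"])
      then show "l t = inverse L * ln t" using LIMSEQ_unique[OF lim[OF t]] by blast
    qed
  next
    case True
    have "\<forall>\<^sub>F t in at_top. 0 < (1 / bracket_energy t) / t"
      using eventually_gt_at_top[of 0] by eventually_elim (simp add: pos)
    then have "LIM t at_top. inverse ((1 / bracket_energy t) / t) :> at_top"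
      using filterlim_inverse_at_top L True by blast
    then have q: "LIM t at_top. t * bracket_energy t :> at_top" by (simp only: recip)
    obtain \<xi> where \<xi>: "filterlim \<xi> at_top sequentially"
        "\<And>i. log_det (s i * 2) - log_det (s i) = ln 2 * (\<xi> i * bracket_energy (\<xi> i))"
        using ex[of 2] by auto
    have "LIM i sequentially. ln 2 * (\<xi> i * bracket_energy (\<xi> i)) :> at_top"
      by (rule filterlim_tendsto_pos_mult_at_top[OF tendsto_const _ filterlim_compose[OF q \<xi>(1)]]) simp
    then have "LIM i sequentially. log_det (s i * 2) - log_det (s i) :> at_infinity"
      unfolding \<xi>(2) by (rule filterlim_at_top_imp_at_infinity)
    then have False
      using not_tendsto_and_filterlim_at_infinity[OF trivial_limit_sequentially lim[OF zero_less_numeral]]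
      by blast
    then show ?thesis ..
  qed
qed

text \<open>
  Differentiating three times gives \<open>f = c/t\<close>, \<open>\<langle>\<delta>(Rc), \<mu>\<rangle> = 4 N = c/(2 t\<^sup>2)\<close> and
  \<open>|\<delta>(Rc)|\<^sup>2 = c/(4 t\<^sup>3)\<close>, so that the squared norm of \<open>\<delta>(Rc) - \<mu>/(2t)\<close> is zero.
\<close>

lemma log_det_logarithmic_imp_soliton:
  assumes log: "\<And>t. 0 < t \<Longrightarrow> log_det t = a + c * ln t" and t: "0 < t"
  shows "delta br (R t) x y = (1 / (2 * t)) *\<^sub>R br x y"
proof -
  interpret metric_bracket "b t" br by (rule static[OF t])
  have f: "bracket_energy t = c / t" if t: "0 < t" for t
  proof -
    have "((\<lambda>t. a + c * ln t) has_real_derivative c / t) (at t)"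
      using t by (auto intro!: derivative_eq_intros)
    then have "(log_det has_real_derivative c / t) (at t)"
      by (rule has_field_derivative_transform_within_open[OF _ positive_times])
         (use t log in auto)
    then show ?thesis using DERIV_unique has_derivative_log_det[OF t] by blast
  qed
  have N: "Ric_energy t = c / (8 * t\<^sup>2)" if t: "0 < t" for t
  proof -
    have "((\<lambda>t. c / t) has_real_derivative - c / t\<^sup>2) (at t)"
      using t by (auto intro!: derivative_eq_intros simp: power2_eq_square)
    then have "(bracket_energy has_real_derivative - c / t\<^sup>2) (at t)"
      by (rule has_field_derivative_transform_within_open[OF _ positive_times])
         (use t f in auto)
    then show ?thesis using DERIV_unique[OF has_derivative_bracket_energy[OF t]] by fastforce
  qed
  have "((\<lambda>t. c / (8 * t\<^sup>2)) has_real_derivative - c / (4 * t ^ 3)) (at t)"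
    using t by (auto intro!: derivative_eq_intros simp: field_simps power2_eq_square power3_eq_cube)
  then have "(Ric_energy has_real_derivative - c / (4 * t ^ 3)) (at t)"
    by (rule has_field_derivative_transform_within_open[OF _ positive_times])
       (use t N in auto)
  then have M: "tensor_ip (b t) (delta br (R t)) (delta br (R t)) = c / (4 * t ^ 3)"
    using DERIV_unique[OF has_derivative_Ric_energy[OF t]] by fastforce
  let ?Q = "\<lambda>x y. delta br (R t) x y - (1 / (2 * t)) *\<^sub>R br x y"
  have bd: "bilinear (delta br (R t))" by (rule bilinear_delta[OF linear_Rc])
  have "tensor_ip (b t) ?Q ?Q = c / (4 * t ^ 3) - 2 * (1 / (2 * t)) * (4 * (c / (8 * t\<^sup>2))) +
      (1 / (2 * t))\<^sup>2 * (c / t)"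
    unfolding tensor_ip_square_diff[OF ip bd bil_br] M tensor_ip_delta_Rc[OF t] N[OF t]
      f[OF t, unfolded bracket_energy_def] ..
  also have "\<dots> = 0" using t by (simp add: field_simps power2_eq_square power3_eq_cube)
  finally have "?Q x y = 0"
    by (rule tensor_ip_eq_0[OF ip bilinear_diff_scaleR[OF bd bil_br]])
  then show ?thesis by simp
qed

end

section \<open>Charts and tangent maps\<close>

lemma chart_at:
  assumes "smooth_atlas A"
  shows chart_at_in: "chart_at A p \<in> A" and in_chart_at: "p \<in> fst (chart_at A p)"
proof -
  have "p \<in> (\<Union>c\<in>A. fst c)" using assms by (simp add: smooth_atlas_def)
  then have "\<exists>c. c \<in> A \<and> p \<in> fst c" by blast
  from someI_ex[OF this] show "chart_at A p \<in> A" "p \<in> fst (chart_at A p)"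
    unfolding chart_at_def by auto
qed

lemma chart:
  assumes A: "smooth_atlas A" and c: "c \<in> A"
  shows open_chart_domain: "open (fst c)" and open_chart_image: "open (snd c ` fst c)"
    and chart_inv_chart: "p \<in> fst c \<Longrightarrow> chart_inv c (snd c p) = p"
    and chart_chart_inv: "z \<in> snd c ` fst c \<Longrightarrow> snd c (chart_inv c z) = z"
    and chart_inv_in: "z \<in> snd c ` fst c \<Longrightarrow> chart_inv c z \<in> fst c"
    and continuous_chart_inv: "continuous_on (snd c ` fst c) (chart_inv c)"
    and inj_on_chart: "inj_on (snd c) (fst c)"
proof -
  obtain U \<kappa> where c': "c = (U, \<kappa>)" by (cases c)
  have "open U \<and> open (\<kappa> ` U) \<and> homeomorphism U (\<kappa> ` U) \<kappa> (chart_inv (U, \<kappa>))"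
    using A c unfolding smooth_atlas_def c' by blast
  then show "open (fst c)" "open (snd c ` fst c)" "p \<in> fst c \<Longrightarrow> chart_inv c (snd c p) = p"
    "z \<in> snd c ` fst c \<Longrightarrow> snd c (chart_inv c z) = z"
    "z \<in> snd c ` fst c \<Longrightarrow> chart_inv c z \<in> fst c"
    "continuous_on (snd c ` fst c) (chart_inv c)" "inj_on (snd c) (fst c)"
    unfolding c' homeomorphism_def by (auto intro: inj_on_inverseI)
qed

lemma chart_transition_smooth:
  assumes A: "smooth_atlas A" and "c \<in> A" "c' \<in> A"
  shows "smooth_on (snd c ` (fst c \<inter> fst c')) (snd c' \<circ> chart_inv c)"
proof -
  from bspec[OF A[unfolded smooth_atlas_def, THEN conjunct2, THEN conjunct2] assms(2)]
  have "\<forall>d\<in>A. smooth_on (snd c ` (fst c \<inter> fst d)) (snd d \<circ> chart_inv c)"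
    by (simp add: case_prod_beta)
  then show ?thesis using assms(3) by (rule bspec)
qed

lemma smooth_on_differentiable: "smooth_on S f \<Longrightarrow> x \<in> S \<Longrightarrow> f differentiable (at x)"
  unfolding smooth_on_def by (drule spec[of _ "[]"]) simp

lemma smooth_on_directional_differentiable:
  assumes "smooth_on S f" "x \<in> S"
  shows "(\<lambda>x. frechet_derivative f (at x) v) differentiable (at x)"
  using assms(1)[unfolded smooth_on_def, rule_format, OF assms(2), of "[v]"] by simp

lemma smooth_map_on_chart:
  assumes "smooth_map_on A B S f" "c \<in> A" "c' \<in> B"
  shows "smooth_on (snd c ` (S \<inter> fst c \<inter> f -` fst c')) (snd c' \<circ> f \<circ> chart_inv c)"
proof -
  from bspec[OF assms(1)[unfolded smooth_map_on_def, THEN conjunct2] assms(2)]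
  have "\<forall>d\<in>B. smooth_on (snd c ` (S \<inter> fst c \<inter> f -` fst d)) (snd d \<circ> f \<circ> chart_inv c)"
    by (simp add: case_prod_beta)
  then show ?thesis using assms(3) by (rule bspec)
qed

lemma linear_tangent_map:
  assumes A: "smooth_atlas A" and B: "smooth_atlas B" and f: "smooth_map_on A B S f" and p: "p \<in> S"
  shows "linear (tangent_map A B f p)"
  unfolding tangent_map_def
  by (intro linear_frechet_derivative smooth_on_differentiable[OF smooth_map_on_chart[OF f]])
     (use p in_chart_at[OF A] in_chart_at[OF B] chart_at_in[OF A] chart_at_in[OF B] in auto)

lemma chart_at_euclid_atlas: "chart_at euclid_atlas z = (UNIV, id)"
  by (simp add: chart_at_def euclid_atlas_def) (rule some_equality, auto)

lemma chart_inv_UNIV_id: "chart_inv (UNIV, id) = id"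
  by (auto simp: chart_inv_def inv_into_def)

text \<open>
  In the chosen chart at \<open>p\<close> the identification of \<open>T\<^sub>p\<close> with the model space is the identity, so the
  components of a metric at \<open>p\<close> are its values.
\<close>

lemma metric_in_chart_at:
  fixes A :: "('m::{t2_space, second_countable_topology}, 'e::euclidean_space) atlas"
  assumes A: "smooth_atlas A"
  shows "metric_in_chart A (chart_at A p) h (snd (chart_at A p) p) u v = h p u v"
proof -
  let ?c = "chart_at A p"
  let ?z = "snd ?c p"
  note c = chart_at_in[OF A, of p] and p = in_chart_at[OF A, of p]
  have inv: "chart_inv ?c ?z = p" by (rule chart_inv_chart[OF A c p])
  have "((snd ?c \<circ> chart_inv ?c \<circ> id) has_derivative id) (at ?z)"
    by (rule has_derivative_transform_within_open[OF has_derivative_id open_chart_image[OF A c]])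
       (use p in \<open>auto simp: chart_inv_chart[OF A c]\<close>)
  then have "frechet_derivative (snd ?c \<circ> chart_inv ?c \<circ> id) (at ?z) = id"
    by (rule frechet_derivative_at[symmetric])
  then have "tangent_map euclid_atlas A (chart_inv ?c) ?z = id"
    unfolding tangent_map_def chart_at_euclid_atlas chart_inv_UNIV_id inv snd_conv id_apply .
  then show ?thesis unfolding metric_in_chart_def pullback_def inv by simp
qed

section \<open>Left translations in charts\<close>

lemma chart_inv_prod:
  assumes A: "smooth_atlas A" and c: "c \<in> A" "c' \<in> A"
    and z: "z \<in> snd c ` fst c" and w: "w \<in> snd c' ` fst c'"
  shows "chart_inv (fst c \<times> fst c', map_prod (snd c) (snd c')) (z, w) = (chart_inv c z, chart_inv c' w)"
  unfolding chart_inv_def[of "(_ \<times> _, _)"] fst_conv snd_conv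
  by (rule inv_into_f_eq)
     (use assms in \<open>auto simp: chart_inv_in[OF A] chart_chart_inv[OF A]
        intro!: map_prod_inj_on inj_on_chart[OF A]\<close>)

text \<open>
  The coordinate expression of the multiplication. All facts about left translations and
  left-invariant fields are read off from its smoothness as a function of both factors.
\<close>

definition mult_in_charts where
  "mult_in_charts \<G> c1 c2 c3 = snd c3 \<circ> (\<lambda>(p, q). p \<otimes>\<^bsub>\<G>\<^esub> q) \<circ>
     chart_inv (fst c1 \<times> fst c2, map_prod (snd c1) (snd c2))"

text \<open>
  The derivative at \<open>z0\<close> depends only on the values near \<open>z0\<close>, so it inherits linearity in the
  parameter \<open>x\<close> from a neighbourhood.
\<close>

lemma linear_frechet_derivative_param:
  assumes S: "open S" "z0 \<in> S" and lin: "\<And>z. z \<in> S \<Longrightarrow> linear (\<lambda>x. W x z)"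
    and D: "\<And>x. W x differentiable (at z0)"
  shows "linear (\<lambda>x. frechet_derivative (W x) (at z0) v)"
proof (rule linearI)
  have W: "(W x has_derivative frechet_derivative (W x) (at z0)) (at z0)" for x
    using D by (simp add: frechet_derivative_works)
  fix x y r
  have "(W (x + y) has_derivative (\<lambda>v. frechet_derivative (W x) (at z0) v + frechet_derivative (W y) (at z0) v)) (at z0)"
    by (rule has_derivative_transform_within_open[OF has_derivative_add[OF W W] S])
       (simp add: linear_add[OF lin])
  from frechet_derivative_at[OF this]
  show "frechet_derivative (W (x + y)) (at z0) v = frechet_derivative (W x) (at z0) v + frechet_derivative (W y) (at z0) v"
    by metis
  have "(W (r *\<^sub>R x) has_derivative (\<lambda>v. r *\<^sub>R frechet_derivative (W x) (at z0) v)) (at z0)"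
    by (rule has_derivative_transform_within_open[OF has_derivative_scaleR_right[OF W] S])
       (simp add: linear_scale[OF lin])
  from frechet_derivative_at[OF this]
  show "frechet_derivative (W (r *\<^sub>R x)) (at z0) v = r *\<^sub>R frechet_derivative (W x) (at z0) v"
    by metis
qed

locale lie_group_charts =
  fixes A :: "('g::{t2_space, second_countable_topology}, 'e::euclidean_space) atlas"
    and \<G> :: "'g monoid" (structure)
  assumes lie: "lie_group A \<G>"
begin

lemma atlas: "smooth_atlas A" and group: "group \<G>" and carrier: "carrier \<G> = UNIV"
  using lie by (auto simp: lie_group_def)

lemma smooth_on_mult_in_charts:
  assumes "c1 \<in> A" "c2 \<in> A" "c3 \<in> A" "p \<in> fst c1" "q \<in> fst c2" "p \<otimes> q \<in> fst c3"
  obtains S where "smooth_on S (mult_in_charts \<G> c1 c2 c3)" "(snd c1 p, snd c2 q) \<in> S"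
proof -
  let ?m = "\<lambda>(p, q). p \<otimes> q"
  let ?c = "(fst c1 \<times> fst c2, map_prod (snd c1) (snd c2))"
  have c: "?c \<in> prod_atlas A A"
    unfolding prod_atlas_def mem_Collect_eq
    by (intro exI[of _ "fst c1"] exI[of _ "snd c1"] exI[of _ "fst c2"] exI[of _ "snd c2"])
      (use assms(1,2) in simp)
  have "smooth_map_on (prod_atlas A A) A UNIV ?m" using lie by (simp add: lie_group_def)
  from smooth_map_on_chart[OF this c assms(3)]
  have "smooth_on (snd ?c ` (UNIV \<inter> fst ?c \<inter> ?m -` fst c3)) (mult_in_charts \<G> c1 c2 c3)"
    unfolding mult_in_charts_def snd_conv fst_conv .
  moreover have "(snd c1 p, snd c2 q) \<in> snd ?c ` (UNIV \<inter> fst ?c \<inter> ?m -` fst c3)"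
    using assms(4-6) by (intro image_eqI[of _ _ "(p, q)"]) auto
  ultimately show ?thesis by (rule that)
qed

lemma left_mult_has_derivative:
  assumes c: "c1 \<in> A" "c2 \<in> A" "c3 \<in> A" and pq: "p \<in> fst c1" "q \<in> fst c2" "p \<otimes> q \<in> fst c3"
  shows "((snd c3 \<circ> (\<lambda>q. p \<otimes> q) \<circ> chart_inv c2) has_derivative
     (\<lambda>v. frechet_derivative (mult_in_charts \<G> c1 c2 c3) (at (snd c1 p, snd c2 q)) (0, v))) (at (snd c2 q))"
proof -
  let ?M = "mult_in_charts \<G> c1 c2 c3"
  obtain S where S: "smooth_on S ?M" "(snd c1 p, snd c2 q) \<in> S"
    using smooth_on_mult_in_charts[OF c pq] by blast
  have "?M differentiable (at (snd c1 p, snd c2 q))" by (rule smooth_on_differentiable[OF S])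
  then have M: "(?M has_derivative frechet_derivative ?M (at (snd c1 p, snd c2 q))) (at (snd c1 p, snd c2 q))"
    by (simp add: frechet_derivative_works)
  have "((\<lambda>w. (snd c1 p, w)) has_derivative (\<lambda>v. (0, v))) (at (snd c2 q))"
    by (intro has_derivative_Pair has_derivative_const has_derivative_ident)
  from has_derivative_compose[OF this M]
  show ?thesis
  proof (rule has_derivative_transform_within_open[OF _ open_chart_image[OF atlas c(2)]])
    show "snd c2 q \<in> snd c2 ` fst c2" using pq by blast
    fix w assume w: "w \<in> snd c2 ` fst c2"
    have z: "snd c1 p \<in> snd c1 ` fst c1" using pq by blast
    show "?M (snd c1 p, w) = (snd c3 \<circ> (\<lambda>q. p \<otimes> q) \<circ> chart_inv c2) w"
      using chart_inv_prod[OF atlas c(1,2) z w] chart_inv_chart[OF atlas c(1) pq(1)]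
      by (simp add: mult_in_charts_def)
  qed
qed

lemma linear_left_translation: "linear (tangent_map A A (\<lambda>q. p \<otimes> q) q)"
proof -
  note h = left_mult_has_derivative[OF chart_at_in[OF atlas] chart_at_in[OF atlas] chart_at_in[OF atlas]
      in_chart_at[OF atlas] in_chart_at[OF atlas] in_chart_at[OF atlas], of p q]
  show ?thesis
    unfolding tangent_map_def
    by (rule linear_frechet_derivative) (use h in \<open>auto simp: differentiable_def\<close>)
qed

text \<open>
  The linear map is the differential of the left translation that takes \<open>a\<close> to the identity. It is
  the same for all invariant metrics, in particular for all times of a flow.
\<close>

lemma invariant_metric_translate:
  obtains P where "linear P"
    "\<And>h u v. invariant_metric A \<G> h \<Longrightarrow> h a u v = h \<one> (P u) (P v)"
proof
  let ?P = "tangent_map A A (\<lambda>q. inv a \<otimes> q) a"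
  show "linear ?P" by (rule linear_left_translation)
  fix h :: "('g, 'e) metric" and u v assume h: "invariant_metric A \<G> h"
  have "inv a \<otimes> a = \<one>" using group.l_inv[OF group] carrier by simp
  moreover have "pullback A A (\<lambda>q. inv a \<otimes> q) h a u v = h a u v"
    using h unfolding invariant_metric_def by metis
  ultimately show "h a u v = h \<one> (?P u) (?P v)"
    unfolding pullback_def by simp
qed

text \<open>
  By the chain rule the coordinate expression of a left-invariant field is the partial derivative of
  the multiplication in its second argument. The chart chosen at the varying point \<open>chart_inv c z\<close>,
  which need not vary continuously, cancels.
\<close>

lemma left_invariant_field_in_chart:
  assumes z: "z \<in> snd (chart_at A \<one>) ` fst (chart_at A \<one>)"
  shows "field_in_chart A (chart_at A \<one>) (left_invariant_field A \<G> x) z =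
     frechet_derivative (mult_in_charts \<G> (chart_at A \<one>) (chart_at A \<one>) (chart_at A \<one>))
       (at (z, snd (chart_at A \<one>) \<one>)) (0, x)"
proof -
  let ?c = "chart_at A \<one>"
  let ?p = "chart_inv ?c z"
  let ?c' = "chart_at A ?p"
  let ?L = "\<lambda>q. ?p \<otimes> q"
  let ?w = "snd ?c \<one>"
  note c = chart_at_in[OF atlas, of "\<one>"] and c' = chart_at_in[OF atlas, of ?p]
  note one = in_chart_at[OF atlas, of "\<one>"] and pc' = in_chart_at[OF atlas, of ?p]
  have p: "?p \<in> fst ?c" "snd ?c ?p = z"
    using chart_inv_in[OF atlas c z] chart_chart_inv[OF atlas c z] by auto
  have p1: "?p \<otimes> \<one> = ?p"
    using monoid.r_one[OF group.is_monoid[OF group]] carrier by simp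
  let ?G = "snd ?c' \<circ> ?L \<circ> chart_inv ?c" and ?F = "snd ?c \<circ> chart_inv ?c'"
  have G: "(?G has_derivative tangent_map A A ?L \<one>) (at ?w)"
    unfolding tangent_map_def p1
    using left_mult_has_derivative[OF c c c' p(1) one] pc' p1
    by (auto simp: differentiable_def simp flip: frechet_derivative_works)
  have F: "(?F has_derivative tangent_map A euclid_atlas (snd ?c) ?p) (at (snd ?c' ?p))"
    unfolding tangent_map_def chart_at_euclid_atlas snd_conv id_comp frechet_derivative_works[symmetric]
    by (rule smooth_on_differentiable[OF chart_transition_smooth[OF atlas c' c]]) (use p pc' in blast)
  have "?G ?w = snd ?c' ?p" by (simp add: chart_inv_chart[OF atlas c one] p1)
  then have FG: "(?F \<circ> ?G has_derivative
      tangent_map A euclid_atlas (snd ?c) ?p \<circ> tangent_map A A ?L \<one>) (at ?w)"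
    using diff_chain_at[OF G] F by simp
  \<comment> \<open>The charts at \<open>?p\<close> cancel only where the translated point stays in the domain of \<open>?c'\<close>.\<close>
  let ?S = "(snd ?c ` fst ?c) \<inter> (?L \<circ> chart_inv ?c) -` fst ?c'"
  have "continuous_on UNIV (\<lambda>(p, q). p \<otimes> q)"
    using lie by (simp add: lie_group_def smooth_map_on_def)
  then have "continuous_on UNIV ?L"
    using continuous_on_compose2[of UNIV "\<lambda>(p, q). p \<otimes> q" UNIV "\<lambda>q. (?p, q)"]
    by (simp add: continuous_on_Pair)
  then have "continuous_on (snd ?c ` fst ?c) (?L \<circ> chart_inv ?c)"
    by (intro continuous_on_compose continuous_chart_inv[OF atlas c]) (rule continuous_on_subset, auto)
  then have openS: "open ?S"
    using open_chart_image[OF atlas c] open_chart_domain[OF atlas c']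
    by (metis continuous_on_open_vimage inf_commute)
  have "?w \<in> ?S" using one pc' by (simp add: chart_inv_chart[OF atlas c one] p1)
  with FG openS have "((snd ?c \<circ> ?L \<circ> chart_inv ?c) has_derivative
      tangent_map A euclid_atlas (snd ?c) ?p \<circ> tangent_map A A ?L \<one>) (at ?w)"
    by (rule has_derivative_transform_within_open) (simp add: chart_inv_chart[OF atlas c'])
  from has_derivative_unique[OF this left_mult_has_derivative[OF c c c p(1) one]] p p1
  show ?thesis
    unfolding field_in_chart_def left_invariant_field_def by (metis comp_apply)
qed

text \<open>
  Bilinearity requires that the coordinate expressions of left-invariant fields are differentiable
  and depend linearly on the vector at the identity. Differentiability comes from the mixed second
  derivatives of the multiplication.
\<close>

lemma bilinear_lie_bracket: "bilinear (lie_bracket A \<G>)"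
proof -
  let ?c = "chart_at A \<one>"
  let ?M = "mult_in_charts \<G> ?c ?c ?c"
  let ?z = "snd ?c \<one>" and ?S = "snd ?c ` fst ?c"
  define W where "W x = field_in_chart A ?c (left_invariant_field A \<G> x)" for x
  note c = chart_at_in[OF atlas, of "\<one>"] and one = in_chart_at[OF atlas, of "\<one>"]
  have S: "open ?S" "?z \<in> ?S" using open_chart_image[OF atlas c] one by auto
  have W: "W x z = frechet_derivative ?M (at (z, ?z)) (0, x)" if "z \<in> ?S" for x z
    unfolding W_def by (rule left_invariant_field_in_chart[OF that])
  have r1: "p \<otimes> \<one> = p" for p
    using monoid.r_one[OF group.is_monoid[OF group]] carrier by simp
  have lin: "linear (\<lambda>x. W x z)" if z: "z \<in> ?S" for z
  proof -
    have p: "chart_inv ?c z \<in> fst ?c" "snd ?c (chart_inv ?c z) = z"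
      using chart_inv_in[OF atlas c z] chart_chart_inv[OF atlas c z] by auto
    have "linear (\<lambda>x. frechet_derivative ?M (at (z, ?z)) (0, x))"
      using left_mult_has_derivative[OF c c c p(1) one] p r1 by (metis has_derivative_linear)
    then show ?thesis by (simp only: W[OF z])
  qed
  have D: "W x differentiable (at ?z)" for x
  proof -
    obtain T where T: "smooth_on T ?M" "(?z, ?z) \<in> T"
      using smooth_on_mult_in_charts[OF c c c one one] one r1 by metis
    have "((\<lambda>y. frechet_derivative ?M (at y) (0, x)) \<circ> (\<lambda>z. (z, ?z))) differentiable (at ?z)"
      by (intro differentiable_chain_at smooth_on_directional_differentiable[OF T])
         (auto simp: differentiable_def intro!: exI has_derivative_Pair derivative_intros)
    then obtain D where "(((\<lambda>y. frechet_derivative ?M (at y) (0, x)) \<circ> (\<lambda>z. (z, ?z))) has_derivative D) (at ?z)"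
      by (auto simp: differentiable_def)
    then have "(W x has_derivative D) (at ?z)"
      by (rule has_derivative_transform_within_open[OF _ S]) (simp add: W)
    then show ?thesis by (auto simp: differentiable_def)
  qed
  have br: "lie_bracket A \<G> x y = frechet_derivative (W y) (at ?z) (W x ?z) - frechet_derivative (W x) (at ?z) (W y ?z)" for x y
    unfolding lie_bracket_def field_bracket_def Let_def W_def ..
  note l1 = linear_frechet_derivative_param[OF S lin D] and l2 = linear_frechet_derivative[OF D] and l3 = lin[OF S(2)]
  show ?thesis
    unfolding bilinear_def linear_iff br
    by (simp add: linear_add[OF l1] linear_scale[OF l1] linear_add[OF l2] linear_scale[OF l2]
        linear_add[OF l3] linear_scale[OF l3] scaleR_diff_right)
qed

lemma lie_bracket_antisym: "lie_bracket A \<G> x y = - lie_bracket A \<G> y x"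
  by (simp add: lie_bracket_def field_bracket_def Let_def)

end

section \<open>Blowdown limits\<close>

text \<open>
  At the base point \<open>p\<close> every pulled back metric is an inner product on the one space \<open>T\<^sub>p\<close>, so that
  uniform convergence in a chart, on the compact set consisting of a single point and time, is
  convergence of inner products on \<open>T\<^sub>p\<close>.
\<close>

lemma blowdown_limit_pointwise:
  fixes A :: "('g::{t2_space, second_countable_topology}, 'e::euclidean_space) atlas"
    and A' :: "('h::{t2_space, second_countable_topology}, 'e) atlas"
  assumes A: "smooth_atlas A" and A': "smooth_atlas A'" and lim: "sequential_blowdown_limit A' G A h"
  obtains s T a p where "\<And>i. 0 < s i" "filterlim s at_top sequentially" "\<And>i. linear (T i)"
    "\<And>t u v. 0 < t \<Longrightarrow>
       (\<lambda>i. inverse (s i) * G (s i * t) (a i) (T i u) (T i v)) \<longlonglongrightarrow> h t p u v"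
proof -
  obtain s a p where s: "\<forall>i. 0 < s i" "filterlim s at_top sequentially"
    and cg: "cheeger_gromov_converges A' a (\<lambda>i t p u v. inverse (s i) * G (s i * t) p u v) A p h"
    using lim unfolding sequential_blowdown_limit_def by (elim exE conjE) (rule that)
  obtain U V \<phi> where \<phi>: "\<forall>i. open (U i) \<and> p \<in> U i \<and> open (V i) \<and>
        diffeomorphism_between A A' (U i) (V i) (\<phi> i) \<and> \<phi> i p = a i"
    and conv: "smooth_convergence A
        (\<lambda>i t. pullback A A' (\<phi> i) (\<lambda>p u v. inverse (s i) * G (s i * t) p u v)) h"
    using cg unfolding cheeger_gromov_converges_def by (elim exE conjE) (rule that)
  let ?T = "\<lambda>i. tangent_map A A' (\<phi> i) p"
  let ?c = "chart_at A p"
  let ?z = "snd ?c p"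
  have "linear (?T i)" for i
    using \<phi> by (intro linear_tangent_map[OF A A', of "U i"]) (auto simp: diffeomorphism_between_def)
  moreover have "(\<lambda>i. inverse (s i) * G (s i * t) (a i) (?T i u) (?T i v)) \<longlonglongrightarrow> h t p u v"
    if t: "0 < t" for t u v
  proof -
    let ?H = "\<lambda>i t. pullback A A' (\<phi> i) (\<lambda>p u v. inverse (s i) * G (s i * t) p u v)"
    have K: "compact {(?z, t)} \<and> {(?z, t)} \<subseteq> (snd ?c ` fst ?c) \<times> {0<..}"
      using t in_chart_at[OF A] by auto
    have "uniform_limit {(?z, t)} (\<lambda>i. iterated_deriv [] (\<lambda>(z, t). metric_in_chart A ?c (?H i t) z u v))
          (iterated_deriv [] (\<lambda>(z, t). metric_in_chart A ?c (h t) z u v)) sequentially"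
      by (rule conv[unfolded smooth_convergence_def, THEN bspec, OF chart_at_in[OF A],
            THEN spec, THEN spec, THEN spec, THEN spec, THEN mp, OF K])
    from tendsto_uniform_limitI[OF this, of "(?z, t)"]
    have "(\<lambda>i. metric_in_chart A ?c (?H i t) ?z u v) \<longlonglongrightarrow> metric_in_chart A ?c (h t) ?z u v"
      by simp
    moreover have "?H i t p u v = inverse (s i) * G (s i * t) (a i) (?T i u) (?T i v)" for i
      using \<phi> by (simp add: pullback_def)
    ultimately show ?thesis by (simp only: metric_in_chart_at[OF A])
  qed
  ultimately show ?thesis using s by (intro that[of s ?T a p]) auto
qed

lemma flow_on_lie_algebra:
  fixes A :: "('g::{t2_space, second_countable_topology}, 'e::euclidean_space) atlas"
  assumes L: "lie_group A \<G>" and flow: "invariant_ricci_flow A \<G> G"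
  shows "algebraic_ricci_flow (lie_bracket A \<G>) (\<lambda>t. G t \<one>\<^bsub>\<G>\<^esub>)"
proof -
  interpret lie_group_charts A \<G> by unfold_locales (rule L)
  show ?thesis
  proof
    show "bilinear (lie_bracket A \<G>)" by (rule bilinear_lie_bracket)
    show "lie_bracket A \<G> x y = - lie_bracket A \<G> y x" for x y by (rule lie_bracket_antisym)
    fix t :: real assume t: "0 < t"
    show "inner_product (G t \<one>\<^bsub>\<G>\<^esub>)"
      using flow t by (simp add: invariant_ricci_flow_def invariant_metric_def riemannian_metric_def)
    show "((\<lambda>t. G t \<one>\<^bsub>\<G>\<^esub> x y) has_real_derivative
        - 2 * Ric (lie_bracket A \<G>) (G t \<one>\<^bsub>\<G>\<^esub>) x y) (at t)" for x y
      using flow t by (simp add: invariant_ricci_flow_def)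
  qed
qed

text \<open>
  The Gram determinants of the pulled back metrics at the base point are \<open>\<gamma> i\<close> times those of
  \<open>G (s i * t)\<close> at the identity, where \<open>\<gamma> i\<close> collects the rescaling, the diffeomorphism and the left
  translation and does not depend on \<open>t\<close>. Likewise the limit has a constant factor \<open>c\<close>. These factors
  cancel in quotients of determinants at the times \<open>t\<close> and \<open>1\<close>.
\<close>

lemma blowdown_limit_log_det:
  fixes A :: "('g::{t2_space, second_countable_topology}, 'e::euclidean_space) atlas"
    and A' :: "('h::{t2_space, second_countable_topology}, 'e) atlas"
  assumes L: "lie_group A \<G>" and flow: "invariant_ricci_flow A \<G> h"
    and L': "lie_group A' \<G>'" and flow': "invariant_ricci_flow A' \<G>' G"
    and lim: "sequential_blowdown_limit A' G A h"
  obtains s where "\<And>i. 0 < s i" "filterlim s at_top sequentially"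
    "\<And>t. 0 < t \<Longrightarrow>
      (\<lambda>i. algebraic_ricci_flow.log_det (\<lambda>t. G t \<one>\<^bsub>\<G>'\<^esub>) (s i * t) -
           algebraic_ricci_flow.log_det (\<lambda>t. G t \<one>\<^bsub>\<G>'\<^esub>) (s i))
      \<longlonglongrightarrow> algebraic_ricci_flow.log_det (\<lambda>t. h t \<one>\<^bsub>\<G>\<^esub>) t -
           algebraic_ricci_flow.log_det (\<lambda>t. h t \<one>\<^bsub>\<G>\<^esub>) 1"
proof -
  interpret g: lie_group_charts A \<G> by unfold_locales (rule L)
  interpret g': lie_group_charts A' \<G>' by unfold_locales (rule L')
  interpret F: algebraic_ricci_flow "lie_bracket A \<G>" "\<lambda>t. h t \<one>\<^bsub>\<G>\<^esub>"
    by (rule flow_on_lie_algebra[OF L flow])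
  interpret F': algebraic_ricci_flow "lie_bracket A' \<G>'" "\<lambda>t. G t \<one>\<^bsub>\<G>'\<^esub>"
    by (rule flow_on_lie_algebra[OF L' flow'])
  obtain s T a p where s: "\<And>i. 0 < s i" "filterlim s at_top sequentially"
    and T: "\<And>i. linear (T i)"
    and conv: "\<And>t u v. 0 < t \<Longrightarrow>
       (\<lambda>i. inverse (s i) * G (s i * t) (a i) (T i u) (T i v)) \<longlonglongrightarrow> h t p u v"
    by (rule blowdown_limit_pointwise[OF g.atlas g'.atlas lim]) (rule that; (assumption | fast))
  let ?D = "\<lambda>t. gram_det (h t \<one>\<^bsub>\<G>\<^esub>)" and ?E = "\<lambda>t. gram_det (G t \<one>\<^bsub>\<G>'\<^esub>)"
  have inv: "invariant_metric A \<G> (h t)" "invariant_metric A' \<G>' (G t)" if "0 < t" for t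
    using flow flow' that by (auto simp: invariant_ricci_flow_def)

  obtain P where P: "linear P" "\<And>k u v. invariant_metric A \<G> k \<Longrightarrow> k p u v = k \<one>\<^bsub>\<G>\<^esub> (P u) (P v)"
    by (rule g.invariant_metric_translate[of p]) (rule that; (assumption | fast))
  obtain c where "\<And>Q. bilinear Q \<Longrightarrow> gram_det (\<lambda>u v. Q (P u) (P v)) = c * gram_det Q"
    by (rule gram_det_congruence[of P]) (rule that; (assumption | fast))
  then have c: "gram_det (h t p) = c * ?D t" if "0 < t" for t
    using F.bil[OF that] P(2)[OF inv(1)[OF that]] by (simp add: fun_eq_iff[symmetric] cong: gram_det_cong)

  have "\<exists>c. \<forall>t>0. gram_det (\<lambda>u v. inverse (s i) * G (s i * t) (a i) (T i u) (T i v)) = c * ?E (s i * t)" for i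
  proof -
    obtain P' where P': "\<And>k u v. invariant_metric A' \<G>' k \<Longrightarrow> k (a i) u v = k \<one>\<^bsub>\<G>'\<^esub> (P' u) (P' v)"
      by (rule g'.invariant_metric_translate[of "a i"]) (rule that; (assumption | fast))
    \<comment> \<open>The square root absorbs the rescaling of the metric into the linear map.\<close>
    let ?P = "\<lambda>u. (1 / sqrt (s i)) *\<^sub>R P' (T i u)"
    obtain c where c: "\<And>Q. bilinear Q \<Longrightarrow> gram_det (\<lambda>u v. Q (?P u) (?P v)) = c * gram_det Q"
      by (rule gram_det_congruence[of ?P]) (rule that; (assumption | fast))
    have "gram_det (\<lambda>u v. inverse (s i) * G (s i * t) (a i) (T i u) (T i v)) = c * ?E (s i * t)"
      if "0 < t" for t
    proof -
      have st: "0 < s i * t" using s(1)[of i] that by simp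
      note bil = F'.bil[OF st]
      have "inverse (s i) * G (s i * t) (a i) (T i u) (T i v) = G (s i * t) \<one>\<^bsub>\<G>'\<^esub> (?P u) (?P v)" for u v
        using s(1)[of i] P'[OF inv(2)[OF st]]
        by (simp add: bilinear_lmul[OF bil] bilinear_rmul[OF bil] inverse_eq_divide)
      then show ?thesis using c[OF bil] by presburger
    qed
    then show ?thesis by blast
  qed
  then have "\<forall>i. \<exists>c. \<forall>t>0. gram_det (\<lambda>u v. inverse (s i) * G (s i * t) (a i) (T i u) (T i v)) = c * ?E (s i * t)"
    by (rule allI)
  from choice[OF this] obtain \<gamma> where
    \<gamma>: "\<forall>i. \<forall>t>0. gram_det (\<lambda>u v. inverse (s i) * G (s i * t) (a i) (T i u) (T i v)) = \<gamma> i * ?E (s i * t)"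
    ..
  have lim1: "(\<lambda>i. \<gamma> i * ?E (s i * t)) \<longlonglongrightarrow> c * ?D t" if "0 < t" for t
  proof -
    have "(\<lambda>i. gram_det (\<lambda>u v. inverse (s i) * G (s i * t) (a i) (T i u) (T i v))) \<longlonglongrightarrow> gram_det (h t p)"
      by (rule tendsto_gram_det) (rule conv[OF that])
    then show ?thesis using \<gamma> that c[OF that] by simp
  qed
  have D0: "?D t \<noteq> 0" and E0: "?E t \<noteq> 0" if "0 < t" for t
    using gram_det_nonzero[OF F.ip[OF that]] gram_det_nonzero[OF F'.ip[OF that]] by auto
  \<comment> \<open>Nondegeneracy of the limit metric makes \<open>\<gamma> i\<close> nonzero for large \<open>i\<close>, as the
    products \<open>\<gamma> i * ?E (s i * 1)\<close> converge to \<open>c * ?D 1\<close>.\<close>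
  have "inner_product (h 1 p)"
    using inv(1)[of 1] by (simp add: invariant_metric_def riemannian_metric_def)
  then have c0: "c \<noteq> 0" using gram_det_nonzero c[of 1] by force
  have "\<forall>\<^sub>F i in sequentially. \<gamma> i * ?E (s i * 1) \<noteq> 0"
    by (rule tendsto_imp_eventually_ne[OF lim1]) (use c0 D0[of 1] in auto)
  then have \<gamma>0: "\<forall>\<^sub>F i in sequentially. \<gamma> i \<noteq> 0" by eventually_elim auto

  have "(\<lambda>i. F'.log_det (s i * t) - F'.log_det (s i)) \<longlonglongrightarrow> F.log_det t - F.log_det 1"
    if t: "0 < t" for t
  proof -
    have "(\<lambda>i. ((\<gamma> i * ?E (s i * t)) / (\<gamma> i * ?E (s i * 1)))\<^sup>2) \<longlonglongrightarrow> ((c * ?D t) / (c * ?D 1))\<^sup>2"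
      by (intro tendsto_power tendsto_divide lim1 t) (use c0 D0[of 1] in auto)
    then have "(\<lambda>i. ln (((\<gamma> i * ?E (s i * t)) / (\<gamma> i * ?E (s i * 1)))\<^sup>2)) \<longlonglongrightarrow> ln (((c * ?D t) / (c * ?D 1))\<^sup>2)"
      by (rule tendsto_ln) (use c0 D0[of 1] D0[OF t] in simp)
    moreover have q: "ln (((x * y) / (x * z))\<^sup>2) = ln (y\<^sup>2) - ln (z\<^sup>2)" if "x \<noteq> 0" "y \<noteq> 0" "z \<noteq> 0" for x y z :: real
    proof -
      have "((x * y) / (x * z))\<^sup>2 = y\<^sup>2 / z\<^sup>2" using that by (simp add: power_divide)
      then show ?thesis using that by (simp add: ln_div)
    qed
    have "ln (((c * ?D t) / (c * ?D 1))\<^sup>2) = F.log_det t - F.log_det 1"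
      unfolding F.log_det_def by (rule q[OF c0 D0[OF t] D0]) simp
    moreover have "\<forall>\<^sub>F i in sequentially. ln (((\<gamma> i * ?E (s i * t)) / (\<gamma> i * ?E (s i * 1)))\<^sup>2) =
        F'.log_det (s i * t) - F'.log_det (s i)"
      using \<gamma>0
    proof eventually_elim
      case (elim i)
      have "0 < s i * t" "0 < s i * 1" using s(1)[of i] t by auto
      from q[OF elim E0[OF this(1)] E0[OF this(2)]] show ?case
        by (simp only: F'.log_det_def mult_1_right)
    qed
    ultimately show ?thesis by (simp only: tendsto_cong)
  qed
  then show ?thesis using s by (intro that[of s])
qed

theorem proposition1p8:
  fixes A :: "('g::{t2_space, second_countable_topology}, 'e::euclidean_space) atlas"
    and \<G> :: "'g monoid"
    and G_inf :: "real \<Rightarrow> ('g, 'e) metric"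
    and A' :: "('h::{t2_space, second_countable_topology}, 'e) atlas"
    and \<G>' :: "'h monoid"
    and G :: "real \<Rightarrow> ('h, 'e) metric"
  assumes "nilpotent_lie_group A \<G>"
    and "invariant_ricci_flow A \<G> G_inf"
    and "nilpotent_lie_group A' \<G>'"
    and "invariant_ricci_flow A' \<G>' G"
    and "sequential_blowdown_limit A' G A G_inf"
  shows "\<forall>t>0. \<forall>x y.
    delta (lie_bracket A \<G>)
      (\<lambda>z. Rc (lie_bracket A \<G>) (G_inf t \<one>\<^bsub>\<G>\<^esub>) z + (1 / (2 * t)) *\<^sub>R z) x y = 0"
proof (intro allI impI)
  fix t :: real and x y :: 'e
  assume t: "0 < t"
  have L: "lie_group A \<G>" "lie_group A' \<G>'"
    using assms(1,3) by (auto simp: nilpotent_lie_group_def)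
  interpret F: algebraic_ricci_flow "lie_bracket A \<G>" "\<lambda>t. G_inf t \<one>\<^bsub>\<G>\<^esub>"
    by (rule flow_on_lie_algebra[OF L(1) assms(2)])
  interpret F': algebraic_ricci_flow "lie_bracket A' \<G>'" "\<lambda>t. G t \<one>\<^bsub>\<G>'\<^esub>"
    by (rule flow_on_lie_algebra[OF L(2) assms(4)])
  obtain s where s: "\<And>i. 0 < s i" "filterlim s at_top sequentially"
    and lim: "\<And>t. 0 < t \<Longrightarrow> (\<lambda>i. F'.log_det (s i * t) - F'.log_det (s i)) \<longlonglongrightarrow> F.log_det t - F.log_det 1"
    by (rule blowdown_limit_log_det[OF L(1) assms(2) L(2) assms(4,5)]) (rule that; (assumption | fast))
  obtain c where c: "\<And>t. 0 < t \<Longrightarrow> F.log_det t - F.log_det 1 = c * ln t"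
    by (rule F'.log_det_blowdown[OF s lim], assumption) (rule that; (assumption | fast))
  have log: "F.log_det t = F.log_det 1 + c * ln t" if "0 < t" for t
    using c[OF that] by simp
  have bil: "bilinear (lie_bracket A \<G>)" by (rule F.bil_br)
  have "delta (lie_bracket A \<G>) (Rc (lie_bracket A \<G>) (G_inf t \<one>\<^bsub>\<G>\<^esub>)) x y =
      (1 / (2 * t)) *\<^sub>R lie_bracket A \<G> x y"
    by (rule F.log_det_logarithmic_imp_soliton[OF log t])
  then show "delta (lie_bracket A \<G>)
      (\<lambda>z. Rc (lie_bracket A \<G>) (G_inf t \<one>\<^bsub>\<G>\<^esub>) z + (1 / (2 * t)) *\<^sub>R z) x y = 0"
    by (simp add: delta_def bilinear_ladd[OF bil] bilinear_radd[OF bil] bilinear_lmul[OF bil]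
        bilinear_rmul[OF bil] algebra_simps)
qed

end
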